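(* The following four evaluations of infinite series hold: $$\sum_{k=1}^{\infty}\binom{2k}{k}^3\frac{H_k}{64^k}=\frac{2\pi\left(\pi-3\ln 2\right)}{3\,\Gamma^4\left(\frac{3}{4}\right)},\qquad \sum_{k=1}^{\infty}\binom{2k}{k}^3\frac{O_k}{64^k}=\frac{\pi^2}{6\,\Gamma^4\left(\frac{3}{4}\right)},$$ $$\sum_{k=1}^{\infty}\binom{2k}{k}^3\frac{H_k^{(2)}}{64^k}=\frac{\pi(12G-\pi^2)}{3\,\Gamma^4\left(\frac{3}{4}\right)},\qquad \sum_{k=1}^{\infty}\binom{2k}{k}^3\frac{O_k^{(2)}}{64^k}=\frac{\pi(\pi^2-8G)}{8\,\Gamma^4\left(\frac{3}{4}\right)},$$ where $G=\sum_{k=0}^{\infty}\frac{(-1)^k}{(2k+1)^2}$ is Catalan's constant.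
   Context: For integers $k\ge 0$ and $r\ge 1$, $H_k^{(r)}=\sum_{j=1}^{k}\frac{1}{j^r}$ and $O_k^{(r)}=\sum_{j=1}^{k}\frac{1}{(2j-1)^r}$, with $H_k=H_k^{(1)}$ and $O_k=O_k^{(1)}$. $\Gamma$ is the classical Gamma function, and $\Gamma^4(x)$ means $(\Gamma(x))^4$. *)

theory Defs
  imports "HOL-Analysis.Analysis"
begin

definition gen_harm :: "nat \<Rightarrow> nat \<Rightarrow> real" where
  "gen_harm r k = (\<Sum>j=1..k. 1 / real j ^ r)"

definition odd_harm :: "nat \<Rightarrow> nat \<Rightarrow> real" where
  "odd_harm r k = (\<Sum>j=1..k. 1 / (2 * real j - 1) ^ r)"

definition Catalan_const :: real where
  "Catalan_const = (\<Sum>k. (-1) ^ k / (2 * real k + 1) ^ 2)"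

lemma gen_harm_1: "gen_harm 1 k = harm k"
  by (simp add: gen_harm_def harm_def divide_simps)

lemma Catalan_const_sums: "(\<lambda>k. (-1) ^ k / (2 * real k + 1) ^ 2) sums Catalan_const"
proof -
  have "summable (\<lambda>k. 1 / real (Suc k) ^ 2)"
    using inverse_power_summable[of 2, where 'a = real]
    by (subst summable_Suc_iff) (simp add: divide_simps)
  moreover have "norm ((-1) ^ k / (2 * real k + 1) ^ 2) \<le> 1 / real (Suc k) ^ 2" for k
  proof -
    have "(real (Suc k)) ^ 2 \<le> (2 * real k + 1) ^ 2"
      by (rule power_mono) auto
    then have "1 / (2 * real k + 1) ^ 2 \<le> 1 / real (Suc k) ^ 2"
      by (intro divide_left_mono) auto
    moreover have "norm ((-1) ^ k / (2 * real k + 1) ^ 2) = 1 / (2 * real k + 1) ^ 2"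
      by (simp only: norm_divide norm_power norm_minus_cancel norm_one power_one) simp
    ultimately show ?thesis by simp
  qed
  ultimately have "summable (\<lambda>k. (-1) ^ k / (2 * real k + 1) ^ 2)"
    by (rule summable_comparison_test'[where N = 0])
  then show ?thesis
    unfolding Catalan_const_def by (rule summable_sums)
qed

end

theory Submission
  imports Defs "HOL-Complex_Analysis.Complex_Analysis" "HOL-Real_Asymp.Real_Asymp"
begin

text \<open>
  The weight $\binom{2k}{k}^3/64^k = ((1/2)_k/k!)^3$ is the summand of ${}_3F_2(1/2,1/2,1/2;1,1;1)$,
  and perturbing the five parameters produces the harmonic factors. Perturbing Dixon's theorem to
  first order in $a$, respectively in $b$, gives the sums weighted by $2(O_k - H_k)$ and $2O_k + H_k$;
  Dixon's theorem with $b, c = 1/2 \pm s$ and Whipple's theorem with $a = 1/2 + s$ give, to second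
  order in $s$, the sums weighted by $H_k^{(2)} - 4 O_k^{(2)}$ and $-4 O_k^{(2)}$. On the Gamma side
  the derivatives are digamma and trigamma values at multiples of $1/4$, whence
  $\pi$, $\ln 2$ and Catalan's constant.

  Dixon's and Whipple's theorems are proved by the Wilf-Zeilberger method: a telescoping certificate
  relates the series to the one whose parameters are shifted by 2, and under iterated shifts the
  series tends to its first term 1.
\<close>

subsection \<open>Hypergeometric series at 1\<close>

text \<open>The weight is the product over j < k of ((j + 1/2) / (j + 1))^3, so the logarithmic
  derivative of a perturbed term is a sum over j < k of powers of 1 / (j + 1/2) and 1 / (j + 1),
  that is, of odd and ordinary harmonic numbers. Perturbing a pair of parameters by s and -s cancels
  the first order and leaves a function of s^2. With x = s^2 as the parameter only first derivatives
  occur; the price is that the closed form, which contains sqrt x, is available for x \<ge> 0 only.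
  The obstacle is slow convergence: the weight decays like k^(-3/2), so a perturbation may use up
  less than 1/2 of the exponent. This is the origin of the bound 1/24. The shift is by 2 because the
  closed forms contain Gamma values at halved parameters: a shift by 2 moves these by the integer 1,
  so that the closed form changes by a rational factor, as a telescoping relation with rational
  coefficients demands.\<close>

lemma pochhammer_asymptotic:
  fixes x :: real
  assumes "x > 0"
  shows "(\<lambda>n. pochhammer x n / (fact n * real n powr (x - 1))) \<longlonglongrightarrow> 1 / Gamma x"
proof -
  have nz: "Gamma x \<noteq> 0"
    using assms Gamma_real_pos by fastforce
  \<comment> \<open>\<open>Gamma_series x n\<close> contains \<open>pochhammer x (n + 1)\<close>;
    the factor n / (x + n) removes the surplus x + n and lowers the power of n by one.\<close>
  have "(\<lambda>n. real n / (x + real n) / Gamma_series x n) \<longlonglongrightarrow> 1 / Gamma x"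
  proof (rule tendsto_divide[OF _ Gamma_series_LIMSEQ nz])
    show "(\<lambda>n. real n / (x + real n)) \<longlonglongrightarrow> 1"
      by real_asymp
  qed
  moreover have "\<forall>\<^sub>F n in sequentially.
      real n / (x + real n) / Gamma_series x n = pochhammer x n / (fact n * real n powr (x - 1))"
    using eventually_gt_at_top[of 0]
  proof eventually_elim
    case (elim n)
    have "x + real n \<noteq> 0" using assms by simp
    moreover have "exp (x * ln (real n)) = real n powr (x - 1) * real n"
      using elim by (simp add: powr_def exp_diff left_diff_distrib)
    ultimately show ?case
      using elim assms by (simp add: Gamma_series_def pochhammer_Suc divide_simps)
  qed
  ultimately show ?thesis
    by (rule Lim_transform_eventually)
qed

text \<open>The normalisation depends on \<open>x\<close> only through the exponent of n, so
  quotients of shifted Gamma values can be compared by their exponents alone.\<close>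

lemma Gamma_shift_asymptotic:
  fixes x :: real
  assumes "x > 0"
  shows "(\<lambda>n. Gamma (x + real n) / (fact n * real n powr (x - 1))) \<longlonglongrightarrow> 1"
proof -
  have nz: "Gamma x \<noteq> 0"
    using assms Gamma_real_pos by fastforce
  have "(\<lambda>n. pochhammer x n / (fact n * real n powr (x - 1)) * Gamma x) \<longlonglongrightarrow> 1 / Gamma x * Gamma x"
    by (intro tendsto_intros pochhammer_asymptotic assms)
  moreover have "pochhammer x n * Gamma x = Gamma (x + real n)" for n
    using assms nz by (subst pochhammer_Gamma) (auto elim!: nonpos_Ints_cases)
  ultimately show ?thesis
    using nz by simp
qed

section \<open>Terms of 3F2 at 1: decay and convergence\<close>

definition term3F2 :: "real \<Rightarrow> real \<Rightarrow> real \<Rightarrow> real \<Rightarrow> real \<Rightarrow> nat \<Rightarrow> real" where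
  "term3F2 a b c d e k =
     pochhammer a k * pochhammer b k * pochhammer c k / (fact k * pochhammer d k * pochhammer e k)"

lemma term3F2_0 [simp]: "term3F2 a b c d e 0 = 1"
  by (simp add: term3F2_def)

lemma term3F2_Suc:
  "term3F2 a b c d e (Suc k) = term3F2 a b c d e k *
     ((a + k) * (b + k) * (c + k) / ((1 + k) * (d + k) * (e + k)))"
  by (simp add: term3F2_def pochhammer_Suc add_ac mult_ac)

text \<open>Each Pochhammer symbol contributes a factorial, a power of k and a Gamma constant. The
  factorials cancel, and the exponents add up to the parametric excess d + e - a - b - c, plus
  1.\<close>

lemma term3F2_asymptotic:
  assumes "a > 0" "b > 0" "c > 0" "d > 0" "e > 0"
  shows "(\<lambda>k. term3F2 a b c d e k * real k powr (d + e - a - b - c + 1))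
           \<longlonglongrightarrow> Gamma d * Gamma e / (Gamma a * Gamma b * Gamma c)"
proof -
  let ?q = "\<lambda>x k. pochhammer x k / (fact k * real k powr (x - 1)) :: real"
  have G: "Gamma x \<noteq> 0" if "x > 0" for x :: real
    using that Gamma_real_pos by fastforce
  have "(\<lambda>k. ?q a k * ?q b k * ?q c k / (?q d k * ?q e k))
      \<longlonglongrightarrow> (1 / Gamma a) * (1 / Gamma b) * (1 / Gamma c) / ((1 / Gamma d) * (1 / Gamma e))"
    by (intro tendsto_intros pochhammer_asymptotic assms) (simp add: G assms)
  moreover have "\<forall>\<^sub>F k in sequentially. ?q a k * ?q b k * ?q c k / (?q d k * ?q e k) =
      term3F2 a b c d e k * real k powr (d + e - a - b - c + 1)"
    using eventually_gt_at_top[of 0]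
  proof eventually_elim
    case (elim k)
    have "real k powr (d + e - a - b - c + 1) = real k powr (d - 1) * real k powr (e - 1) /
        (real k powr (a - 1) * real k powr (b - 1) * real k powr (c - 1))"
      by (simp flip: powr_add powr_diff) (simp add: algebra_simps)
    then show ?case
      using elim by (simp add: term3F2_def mult_ac)
  qed
  ultimately show ?thesis
    by (simp add: Lim_transform_eventually)
qed

lemma term3F2_nonneg:
  assumes "a > 0" "b > 0" "c > 0" "d > 0" "e > 0"
  shows "term3F2 a b c d e k \<ge> 0"
  unfolding term3F2_def using assms by (intro divide_nonneg_nonneg mult_nonneg_nonneg)
    (auto simp: pochhammer_nonneg)

lemma summable_term3F2:
  assumes "a > 0" "b > 0" "c > 0" "d > 0" "e > 0" and "a + b + c < d + e"
  shows "summable (term3F2 a b c d e)"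
proof -
  define s where "s = d + e - a - b - c + 1"
  have "Bseq (\<lambda>k. term3F2 a b c d e k * real k powr s)"
    unfolding s_def using term3F2_asymptotic[OF assms(1-5)]
    by (intro convergent_imp_Bseq convergentI)
  then obtain K where K: "K > 0" "\<And>k. norm (term3F2 a b c d e k * real k powr s) \<le> K"
    unfolding Bseq_def by auto
  have "\<forall>\<^sub>F k in sequentially. norm (term3F2 a b c d e k) \<le> K * real k powr (-s)"
    using eventually_gt_at_top[of 0]
  proof eventually_elim
    case (elim k)
    show ?case
      using K(2)[of k] elim by (simp add: powr_minus abs_mult field_simps)
  qed
  moreover have "summable (\<lambda>k. K * real k powr (-s))"
    using assms(6) by (intro summable_mult) (simp add: summable_real_powr_iff s_def)
  ultimately show ?thesis
    by (rule summable_comparison_test_ev)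
qed

text \<open>This makes the boundary term of the telescoping sums vanish: there the term is
  multiplied by a quantity of linear growth in k.\<close>

lemma times_term3F2_tendsto_0:
  assumes "a > 0" "b > 0" "c > 0" "d > 0" "e > 0" and "a + b + c < d + e"
  shows "(\<lambda>k. real k * term3F2 a b c d e k) \<longlonglongrightarrow> 0"
proof -
  define r where "r = d + e - a - b - c"
  have r: "r > 0" using assms unfolding r_def by simp
  have "(\<lambda>k. (term3F2 a b c d e k * real k powr (d + e - a - b - c + 1)) * real k powr (-r))
          \<longlonglongrightarrow> Gamma d * Gamma e / (Gamma a * Gamma b * Gamma c) * 0"
  proof (intro tendsto_mult term3F2_asymptotic assms(1-5))
    show "(\<lambda>k. real k powr (-r)) \<longlonglongrightarrow> 0"
      using r by real_asymp
  qed
  moreover have "\<forall>\<^sub>F k in sequentially.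
      (term3F2 a b c d e k * real k powr (d + e - a - b - c + 1)) * real k powr (-r) =
      real k * term3F2 a b c d e k"
    using eventually_gt_at_top[of 0]
  proof eventually_elim
    case (elim k)
    have "real k powr (d + e - a - b - c + 1) * real k powr (-r) = real k"
      using elim by (simp add: r_def flip: powr_add)
    then show ?case
      by (simp add: mult.assoc)
  qed
  ultimately show ?thesis
    by (simp add: Lim_transform_eventually)
qed

text \<open>Supplies the limit under iterated shifts, with a growing lower parameter as
  \<open>N\<close>. For N \<ge> 3 the symbol (N + 1)_k dominates (4)_k = (k + 3)! / 6, which leaves
  a tail with terms 6 / (N (k + 2) (k + 3)); weakening these to 6 / (N (k + 1)^2) lets the Basel sum
  produce pi^2 / N.\<close>

lemma suminf_near_1:
  fixes t :: "nat \<Rightarrow> real"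
  assumes N: "N \<ge> 3" and t0: "t 0 = 1" and nonneg: "\<And>k. t k \<ge> 0"
    and le: "\<And>k. t k \<le> fact k / pochhammer N k"
  shows "\<bar>suminf t - 1\<bar> \<le> pi\<^sup>2 / N"
proof -
  have *: "t (Suc k) \<le> 6 / N * (1 / (real k + 1)\<^sup>2)" for k
  proof -
    have "pochhammer 4 k \<le> pochhammer (N + 1) k"
      using N unfolding pochhammer_prod by (intro prod_mono) auto
    moreover have "(6::real) * pochhammer 4 k = fact (k + 3)"
    proof (induction k)
      case 0
      show ?case by (simp add: fact_numeral)
    next
      case (Suc k)
      have "6 * pochhammer 4 (Suc k) = 6 * pochhammer 4 k * (4 + real k)"
        by (simp add: pochhammer_Suc)
      also have "\<dots> = fact (Suc k + 3)"
        unfolding Suc.IH add_Suc fact_Suc by (simp add: algebra_simps)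
      finally show ?case .
    qed
    ultimately have "fact (k + 3) \<le> 6 * pochhammer (N + 1) k"
      by linarith
    moreover have "(fact (k + 3) :: real) = fact (Suc k) * ((real k + 2) * (real k + 3))"
      by (simp add: eval_nat_numeral algebra_simps)
    ultimately have 1: "fact (Suc k) * ((real k + 2) * (real k + 3)) \<le> 6 * pochhammer (N + 1) k"
      by simp
    have pos: "pochhammer (N + 1) k > 0"
      using N by (simp add: pochhammer_pos)
    have "t (Suc k) \<le> fact (Suc k) / (N * pochhammer (N + 1) k)"
      using le[of "Suc k"] by (simp add: pochhammer_rec)
    also have "\<dots> \<le> 6 / (N * ((real k + 2) * (real k + 3)))"
    proof -
      have "F / (N * P) \<le> 6 / (N * Q)" if "F * Q \<le> 6 * P" "P > 0" "Q > 0" for F P Q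
        using that N by (simp add: divide_simps mult_ac)
      from this[OF 1 pos] show ?thesis by simp
    qed
    also have "\<dots> \<le> 6 / (N * (real k + 1)\<^sup>2)"
      using N unfolding power2_eq_square by (intro divide_left_mono mult_left_mono mult_mono) auto
    finally show ?thesis by simp
  qed
  have S: "(\<lambda>k. 6 / N * (1 / (real k + 1)\<^sup>2)) sums (6 / N * (pi\<^sup>2 / 6))"
    using inverse_squares_sums by (intro sums_mult) (simp add: add_ac)
  have summ: "summable (\<lambda>k. t (Suc k))"
    using * nonneg by (intro summable_comparison_test'[OF sums_summable[OF S], of 0]) auto
  have "suminf t = t 0 + (\<Sum>k. t (Suc k))"
    using suminf_split_head[of t] summ by (simp add: summable_Suc_iff)
  moreover have "0 \<le> (\<Sum>k. t (Suc k))"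
    by (intro suminf_nonneg summ nonneg)
  moreover have "(\<Sum>k. t (Suc k)) \<le> 6 / N * (pi\<^sup>2 / 6)"
    using suminf_le[OF * summ sums_summable[OF S]] sums_unique[OF S] by simp
  ultimately show ?thesis using t0 by simp
qed

lemma suminf_telescope:
  fixes s t G :: "nat \<Rightarrow> real"
  assumes "summable s" "summable t" and "\<And>k. s k - r * t k = G (Suc k) - G k"
    and "G 0 = 0" "G \<longlonglongrightarrow> 0"
  shows "suminf s = r * suminf t"
proof -
  have "(\<lambda>k. G (Suc k) - G k) sums (0 - G 0)"
    by (rule telescope_sums) fact
  then have "(\<lambda>k. s k - r * t k) sums 0"
    using assms by simp
  moreover have "(\<lambda>k. s k - r * t k) sums (suminf s - r * suminf t)"
    by (intro sums_diff sums_mult summable_sums assms)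
  ultimately show ?thesis
    using sums_unique2 by fastforce
qed

section \<open>The relation between a series and its shift by 2\<close>

lemma pochhammer_shift2:
  fixes x :: real
  assumes "x > 0"
  shows "pochhammer (x + 2) k = pochhammer x k * ((x + k) * (x + k + 1)) / (x * (x + 1))"
proof -
  have "pochhammer (x + 2) k * (x * (x + 1)) = pochhammer x k * ((x + k) * (x + k + 1))"
    by (induction k) (simp_all add: pochhammer_Suc algebra_simps)
  then show ?thesis
    using assms by (subst nonzero_eq_divide_eq) auto
qed

lemma quadratic_quotient_tendsto:
  fixes x y :: real
  assumes "x > 0" "y > 0"
  shows "(\<lambda>k. (\<alpha> + \<beta> * real k + \<gamma> * (real k)\<^sup>2) / ((x + real k) * (y + real k))) \<longlonglongrightarrow> \<gamma>"
proof -
  have "(\<lambda>k. \<alpha> * (1 / ((x + real k) * (y + real k))) + \<beta> * (real k / ((x + real k) * (y + real k)))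
          + \<gamma> * ((real k)\<^sup>2 / ((x + real k) * (y + real k)))) \<longlonglongrightarrow> \<alpha> * 0 + \<beta> * 0 + \<gamma> * 1"
  proof (intro tendsto_intros)
    show "(\<lambda>k. 1 / ((x + real k) * (y + real k))) \<longlonglongrightarrow> 0"
      using assms by real_asymp
    show "(\<lambda>k. real k / ((x + real k) * (y + real k))) \<longlonglongrightarrow> 0"
      using assms by real_asymp
    show "(\<lambda>k. (real k)\<^sup>2 / ((x + real k) * (y + real k))) \<longlonglongrightarrow> 1"
      using assms by real_asymp
  qed
  then show ?thesis
    by (simp add: add_divide_distrib)
qed

text \<open>The balance x + y = z + w is what makes the powers of n cancel.\<close>

lemma Gamma_quotient_tendsto_1:
  fixes x y z w :: real
  assumes "x > 0" "y > 0" "z > 0" "w > 0" and "x + y = z + w"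
  shows "(\<lambda>n. Gamma (x + real n) * Gamma (y + real n) / (Gamma (z + real n) * Gamma (w + real n)))
           \<longlonglongrightarrow> 1"
proof -
  let ?q = "\<lambda>x n. Gamma (x + real n) / (fact n * real n powr (x - 1))"
  have "(\<lambda>n. ?q x n * ?q y n / (?q z n * ?q w n)) \<longlonglongrightarrow> 1 * 1 / (1 * 1)"
    by (intro tendsto_intros Gamma_shift_asymptotic assms) auto
  moreover have "\<forall>\<^sub>F n in sequentially. ?q x n * ?q y n / (?q z n * ?q w n) =
      Gamma (x + real n) * Gamma (y + real n) / (Gamma (z + real n) * Gamma (w + real n))"
    using eventually_gt_at_top[of 0]
  proof eventually_elim
    case (elim n)
    have "real n powr (x - 1) * real n powr (y - 1) = real n powr (z - 1) * real n powr (w - 1)"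
      using assms(5) by (simp flip: powr_add)
    moreover have "real n powr u \<noteq> 0" for u using elim by simp
    ultimately show ?case by (simp add: divide_simps)
  qed
  ultimately show ?thesis
    by (simp add: Lim_transform_eventually)
qed

lemma Gamma_add_1: "Gamma y = x * Gamma x" if "x > 0" "y = x + 1" for x y :: real
  using that by (auto intro!: Gamma_plus1 elim!: nonpos_Ints_cases)

lemma Gamma_add_2: "Gamma y = x * (x + 1) * Gamma x" if "x > 0" "y = x + 2" for x y :: real
  using Gamma_add_1[of x "x + 1"] Gamma_add_1[of "x + 1" y] that by simp

lemma pochhammer_mono:
  fixes x y :: real
  assumes "0 < x" "x \<le> y"
  shows "pochhammer x k \<le> pochhammer y k"
  using assms unfolding pochhammer_prod by (intro prod_mono) auto

lemma pochhammer_le_fact: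
  fixes x :: real
  assumes "0 < x" "x \<le> 1"
  shows "pochhammer x k \<le> fact k"
  using pochhammer_mono[OF assms, of k] by (simp add: pochhammer_fact)

text \<open>The common core of both summation theorems: one upper and both lower parameters move by
  2 while \<open>b\<close> and \<open>c\<close> stay. The hypothesis \<open>cert\<close> is the
  telescoping relation between the two terms, divided by the unshifted term and multiplied by (d +
  k) (d + k + 1) (e + k) (e + k + 1); it is therefore a polynomial identity in k.\<close>

lemma suminf_term3F2_shift:
  fixes x b c d e r \<alpha> \<beta> \<gamma> :: real and p :: "real \<Rightarrow> real"
  assumes pos: "x > 0" "b > 0" "c > 0" "d > 0" "e > 0" and conv: "x + b + c < d + e"
    and p_def: "\<And>k. p k = \<alpha> + \<beta> * (x + k) + \<gamma> * ((x + k) * (x + k + 1))"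
    and cert: "\<And>k. (d + k) * (d + k + 1) * ((e + k) * (e + k + 1)) - r * ((x + k) * (x + k + 1)) =
      (x + k) * (b + k) * (c + k) * p (k + 1) - k * (d + k + 1) * (e + k + 1) * p k"
  shows "suminf (term3F2 x b c d e) =
    r * (x * (x + 1)) / ((d * (d + 1)) * (e * (e + 1))) * suminf (term3F2 (x + 2) b c (d + 2) (e + 2))"
proof -
  define s where "s = term3F2 x b c d e"
  define t where "t = term3F2 (x + 2) b c (d + 2) (e + 2)"
  define \<rho> where "\<rho> = r * (x * (x + 1)) / ((d * (d + 1)) * (e * (e + 1)))"
  \<comment> \<open>The factor k makes G vanish at 0, and in G (k + 1) it cancels the 1 + k of the
    term ratio. As \<open>p\<close> is quadratic, the multiplier of \<open>s k\<close> grows at most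
    linearly.\<close>
  define G where "G = (\<lambda>k. s k * (real k * p (real k) / ((d + real k) * (e + real k))))"
  have "suminf s = \<rho> * suminf t"
  proof (rule suminf_telescope[where G = G])
    show "summable s" unfolding s_def
      using assms by (intro summable_term3F2) auto
    show "summable t" unfolding t_def
      using assms by (intro summable_term3F2) auto
    show "G 0 = 0" by (simp add: G_def)
    show "G \<longlonglongrightarrow> 0"
    proof -
      have "(\<lambda>k. (real k * s k) * (((\<alpha> + \<beta> * x + \<gamma> * (x * (x + 1))) + (\<beta> + \<gamma> * (2 * x + 1)) * real k +
           \<gamma> * (real k)\<^sup>2) / ((d + real k) * (e + real k)))) \<longlonglongrightarrow> 0 * \<gamma>"
        unfolding s_def using pos conv
        by (intro tendsto_mult times_term3F2_tendsto_0 quadratic_quotient_tendsto) auto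
      moreover have "(\<alpha> + \<beta> * x + \<gamma> * (x * (x + 1))) + (\<beta> + \<gamma> * (2 * x + 1)) * k + \<gamma> * k\<^sup>2 = p k" for k
        unfolding p_def by (simp add: algebra_simps power2_eq_square)
      ultimately show ?thesis
        by (simp add: G_def mult_ac)
    qed
    show "s k - \<rho> * t k = G (Suc k) - G k" for k
    proof -
      define X Y where "X = d + real k" and "Y = e + real k"
      have XY: "X > 0" "Y > 0" using pos by (auto simp: X_def Y_def)
      define Z where "Z = X * (X + 1) * (Y * (Y + 1))"
      have Z: "Z \<noteq> 0" using XY by (simp add: Z_def)
      have "\<rho> * t k = s k * (r * ((x + k) * (x + k + 1)) / Z)"
      proof -
        have *: "(r * x0 / (d0 * e0)) * (px * x2 / x0 * pb * pc / (f * (pd * d2 / d0) * (pe * e2 / e0))) =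
            (px * pb * pc / (f * pd * pe)) * (r * x2 / (d2 * e2))"
          if "x0 \<noteq> 0" "d0 \<noteq> 0" "e0 \<noteq> 0" for x0 d0 e0 px x2 pb pc f pd d2 pe e2 :: real
          using that by (simp add: divide_simps)
        show ?thesis
          unfolding t_def s_def term3F2_def \<rho>_def Z_def X_def Y_def
            pochhammer_shift2[OF pos(1)] pochhammer_shift2[OF pos(4)] pochhammer_shift2[OF pos(5)]
          by (rule *) (use pos in auto)
      qed
      moreover have "G (Suc k) = s k * ((x + k) * (b + k) * (c + k) * p (real k + 1) / Z)"
      proof -
        have step: "s (Suc k) = s k * ((x + k) * (b + k) * (c + k) / ((real k + 1) * X * Y))"
          unfolding s_def term3F2_Suc X_def Y_def by (simp add: add.commute)
        have Suc: "d + real (Suc k) = X + 1" "e + real (Suc k) = Y + 1" "real (Suc k) = real k + 1"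
          by (auto simp: X_def Y_def)
        have *: "u * (v / (k1 * X * Y)) * (k1 * w / ((X + 1) * (Y + 1))) = u * (v * w / Z)"
          if "k1 \<noteq> 0" for u v w k1
          using that by (simp add: Z_def)
        show ?thesis
          unfolding G_def step Suc(1,2) unfolding Suc(3) by (rule *) simp
      qed
      moreover have "G k = s k * (k * (X + 1) * (Y + 1) * p k / Z)"
        using XY unfolding G_def Z_def X_def[symmetric] Y_def[symmetric] by simp
      moreover have "1 - r * ((x + k) * (x + k + 1)) / Z =
          (x + k) * (b + k) * (c + k) * p (real k + 1) / Z - k * (X + 1) * (Y + 1) * p k / Z"
        using cert[of k] Z unfolding X_def[symmetric] Y_def[symmetric] Z_def[symmetric]
        by (simp add: diff_divide_distrib[symmetric] eq_divide_eq) (simp add: left_diff_distrib)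
      ultimately show ?thesis
        by (metis mult.right_neutral right_diff_distrib)
    qed
  qed
  then show ?thesis
    by (simp add: s_def t_def \<rho>_def)
qed

text \<open>
  The quadratic polynomial in the certificate is written in Newton form at the nodes $-a$ and $-a-1$,
  where the factors $a + k$ and $a + k + 1$ annihilate all but one or two terms; its leading
  coefficient is read off from $k^4$. The next certificate is found in the same way.
\<close>

lemma dixon_certificate:
  fixes a b c k :: real and p :: "real \<Rightarrow> real"
  assumes a: "a \<noteq> 0" and D: "a + 2 - 2 * b - 2 * c \<noteq> 0"
    and p_def: "\<And>k. p k = (1 - b) * (1 - c) / a + (- 1) * (a + k) +
                  (- 1 / (a + 2 - 2 * b - 2 * c)) * ((a + k) * (a + k + 1))"
  shows "(1 + a - b + k) * (1 + a - b + k + 1) * ((1 + a - c + k) * (1 + a - c + k + 1)) -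
         (1 + a - b - c) * (2 + a - b - c) * (2 + a - 2 * b) * (2 + a - 2 * c) /
           (a * (a + 2 - 2 * b - 2 * c)) * ((a + k) * (a + k + 1)) =
         (a + k) * (b + k) * (c + k) * p (k + 1) - k * (1 + a - b + k + 1) * (1 + a - c + k + 1) * p k"
proof -
  define D where "D = a + 2 - 2 * b - 2 * c"
  \<comment> \<open>Clearing the denominators of \<open>p\<close> leaves an identity between
    polynomials, which \<open>algebra\<close> can settle.\<close>
  define q where "q = (\<lambda>k. (1 - b) * (1 - c) * D - a * D * (a + k) - a * ((a + k) * (a + k + 1)))"
  have aD: "a * D \<noteq> 0" using a D by (simp add: D_def)
  have p: "p k = q k / (a * D)" for k
    using aD unfolding p_def q_def D_def[symmetric] by (simp add: divide_simps) (simp add: algebra_simps)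
  have core: "(1 + a - b + k) * (1 + a - b + k + 1) * ((1 + a - c + k) * (1 + a - c + k + 1)) * (a * D) -
         (1 + a - b - c) * (2 + a - b - c) * (2 + a - 2 * b) * (2 + a - 2 * c) * ((a + k) * (a + k + 1)) =
         (a + k) * (b + k) * (c + k) * q (k + 1) - k * (1 + a - b + k + 1) * (1 + a - c + k + 1) * q k"
    unfolding q_def D_def by algebra
  have "L - N / (a * D) * V = P * (q1 / (a * D)) - Q * (q0 / (a * D))"
    if "L * (a * D) - N * V = P * q1 - Q * q0" for L N V P q1 Q q0
    using aD that by (simp add: divide_simps)
  from this[OF core] show ?thesis
    unfolding p D_def[symmetric] .
qed

lemma whipple_certificate:
  fixes a c e f k :: real and p :: "real \<Rightarrow> real"
  assumes c: "c \<noteq> 0" "c + 1 \<noteq> 0" and f_def: "f = 1 + 2 * c - e"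
    and p_def: "\<And>k. p k = (e - c) * (f - c) / c + ((e - c) * (f - c) - (1 + c - a) * (a + c)) / (c * (c + 1)) * (c + k)
                  + (- 1 / c) * ((c + k) * (c + k + 1))"
  shows "(e + k) * (e + k + 1) * ((f + k) * (f + k + 1)) -
         (a + e) * (1 - a + e) * (a + f) * (1 - a + f) / (c * (c + 1)) * ((c + k) * (c + k + 1)) =
         (c + k) * (a + k) * (1 - a + k) * p (k + 1) - k * (e + k + 1) * (f + k + 1) * p k"
proof -
  define q where "q = (\<lambda>k. (e - c) * (f - c) * (c + 1) + ((e - c) * (f - c) - (1 + c - a) * (a + c)) * (c + k) -
     (c + 1) * ((c + k) * (c + k + 1)))"
  have nz: "c * (c + 1) \<noteq> 0" using c by simp
  have p: "p k = q k / (c * (c + 1))" for k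
  proof -
    have "u / c + v / (c * (c + 1)) * w + (- 1 / c) * z = (u * (c + 1) + v * w - (c + 1) * z) / (c * (c + 1))"
      for u v w z
      using c by (simp add: divide_simps)
    then show ?thesis
      unfolding p_def q_def .
  qed
  have core: "(e + k) * (e + k + 1) * ((f + k) * (f + k + 1)) * (c * (c + 1)) -
         (a + e) * (1 - a + e) * (a + f) * (1 - a + f) * ((c + k) * (c + k + 1)) =
         (c + k) * (a + k) * (1 - a + k) * q (k + 1) - k * (e + k + 1) * (f + k + 1) * q k"
    unfolding q_def f_def by algebra
  have "L - N / (c * (c + 1)) * V = P * (q1 / (c * (c + 1))) - Q * (q0 / (c * (c + 1)))"
    if "L * (c * (c + 1)) - N * V = P * q1 - Q * q0" for L N V P q1 Q q0
    using nz that by (simp add: divide_simps)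
  from this[OF core] show ?thesis
    unfolding p .
qed


section \<open>The summation theorems of Dixon and Whipple\<close>

lemma dixon_3F2:
  fixes a b c :: real
  assumes "a > 0" "b > 0" "c > 0" "b \<le> 1" "c \<le> 1" and "b + c < 1 + a / 2"
  shows "term3F2 a b c (1 + a - b) (1 + a - c) sums
    (Gamma (1 + a / 2) * Gamma (1 + a / 2 - b - c) * Gamma (1 + a - b) * Gamma (1 + a - c) /
     (Gamma (1 + a) * Gamma (1 + a - b - c) * Gamma (1 + a / 2 - b) * Gamma (1 + a / 2 - c)))"
proof -
  define S where "S = (\<lambda>a. suminf (term3F2 a b c (1 + a - b) (1 + a - c)))"
  define R where "R = (\<lambda>a. Gamma (1 + a / 2) * Gamma (1 + a / 2 - b - c) * Gamma (1 + a - b) * Gamma (1 + a - c) /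
     (Gamma (1 + a) * Gamma (1 + a - b - c) * Gamma (1 + a / 2 - b) * Gamma (1 + a / 2 - c)))"
  have R_pos: "R x > 0" if "x \<ge> a" for x
    unfolding R_def using assms that by (intro divide_pos_pos mult_pos_pos Gamma_real_pos) auto
  \<comment> \<open>Series and closed form obey the same recurrence, so their quotient is constant
    along a, a + 2, a + 4, ... and can be evaluated in the limit, where both tend to 1.\<close>
  have step: "S x / R x = S (x + 2) / R (x + 2)" if "x \<ge> a" for x
  proof -
    \<comment> \<open>The coefficient is predicted by the closed form: it equals R x / R (x + 2),
      here in the shape in which \<open>suminf_term3F2_shift\<close> delivers it.\<close>
    define \<rho> where "\<rho> = (1 + x - b - c) * (2 + x - b - c) * (2 + x - 2 * b) * (2 + x - 2 * c) /
           (x * (x + 2 - 2 * b - 2 * c)) * (x * (x + 1)) /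
           (((1 + x - b) * (1 + x - b + 1)) * ((1 + x - c) * (1 + x - c + 1)))"
    define p where "p = (\<lambda>k. (1 - b) * (1 - c) / x + (- 1) * (x + k) +
                  (- 1 / (x + 2 - 2 * b - 2 * c)) * ((x + k) * (x + k + 1)))"
    have p: "p k = (1 - b) * (1 - c) / x + (- 1) * (x + k) +
                  (- 1 / (x + 2 - 2 * b - 2 * c)) * ((x + k) * (x + k + 1))" for k
      by (simp add: p_def)
    have nz: "x \<noteq> 0" "x + 2 - 2 * b - 2 * c \<noteq> 0" using assms that by auto
    have add_2: "1 + (x + 2) - b = 1 + x - b + 2" "1 + (x + 2) - c = 1 + x - c + 2" by auto
    have "S x = \<rho> * S (x + 2)"
      unfolding S_def \<rho>_def add_2
      using suminf_term3F2_shift[OF _ _ _ _ _ _ p dixon_certificate[OF nz p]] assms that by simp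
    moreover have "R x = \<rho> * R (x + 2)"
    proof -
      have "1 + x - b - c + 1 = 2 + x - b - c" "1 + x + 1 = 2 * (1 + x / 2)" by auto
      note eq = this
      have "Gamma (1 + (x + 2) / 2) = (1 + x / 2) * Gamma (1 + x / 2)"
        "Gamma (1 + (x + 2) / 2 - b - c) = (1 + x / 2 - b - c) * Gamma (1 + x / 2 - b - c)"
        "Gamma (1 + (x + 2) / 2 - b) = (1 + x / 2 - b) * Gamma (1 + x / 2 - b)"
        "Gamma (1 + (x + 2) / 2 - c) = (1 + x / 2 - c) * Gamma (1 + x / 2 - c)"
        using assms that by (intro Gamma_add_1; simp add: field_simps)+
      moreover have "Gamma (1 + (x + 2) - b) = (1 + x - b) * (1 + x - b + 1) * Gamma (1 + x - b)"
        "Gamma (1 + (x + 2) - c) = (1 + x - c) * (1 + x - c + 1) * Gamma (1 + x - c)"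
        "Gamma (1 + (x + 2) - b - c) = (1 + x - b - c) * (2 + x - b - c) * Gamma (1 + x - b - c)"
        "Gamma (1 + (x + 2)) = (1 + x) * (2 * (1 + x / 2)) * Gamma (1 + x)"
        unfolding eq[symmetric] using assms that by (intro Gamma_add_2; simp)+
      moreover have "2 + x - 2 * b = 2 * (1 + x / 2 - b)" "2 + x - 2 * c = 2 * (1 + x / 2 - c)"
        "x + 2 - 2 * b - 2 * c = 2 * (1 + x / 2 - b - c)" "x + 1 = 1 + x"
        by auto
      \<comment> \<open>With Gamma values and linear factors replaced by variables, the recurrence
        for \<open>R\<close> is a plain cancellation.\<close>
      moreover have "g1 * g2 * g3 * g4 / (g5 * g6 * g7 * g8) =
          A * B * (2 * U) * (2 * V) / (x * (2 * K)) * (x * A1) / ((XB * XB') * (XC * XC')) *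
          ((H * g1) * (K * g2) * (XB * XB' * g3) * (XC * XC' * g4) /
            ((A1 * (2 * H) * g5) * (A * B * g6) * (U * g7) * (V * g8)))"
        if "x > 0" "A > 0" "B > 0" "U > 0" "V > 0" "K > 0" "A1 > 0" "XB > 0" "XB' > 0" "XC > 0" "XC' > 0" "H > 0"
        for A B U V K A1 XB XB' XC XC' H g1 g2 g3 g4 g5 g6 g7 g8 :: real
        using that by simp
      note * = this
      ultimately show ?thesis
        unfolding R_def \<rho>_def by (simp only:) (rule *; use assms that in simp)
    qed
    moreover have "R (x + 2) > 0" "R x > 0" using that R_pos by auto
    ultimately show ?thesis by auto
  qed
  have "S a / R a = S (a + real (2 * n)) / R (a + real (2 * n))" for n
  proof (induction n)
    case (Suc n)
    then show ?case using step[of "a + real (2 * n)"] by (simp add: add_ac)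
  qed simp
  moreover have "(\<lambda>n. S (a + real (2 * n)) / R (a + real (2 * n))) \<longlonglongrightarrow> 1 / 1"
  proof (intro tendsto_divide)
    show "(\<lambda>n. S (a + real (2 * n))) \<longlonglongrightarrow> 1"
    proof (rule LIM_zero_cancel, rule Lim_null_comparison)
      show "\<forall>\<^sub>F n in sequentially. norm (S (a + real (2 * n)) - 1) \<le> pi\<^sup>2 / (1 + (a + real (2 * n)) - c)"
        using eventually_ge_at_top[of 2]
      proof eventually_elim
        case (elim n)
        define x where "x = a + real (2 * n)"
        have x: "x > 3" using elim assms by (simp add: x_def)
        have "\<bar>S x - 1\<bar> \<le> pi\<^sup>2 / (1 + x - c)"
          unfolding S_def
        proof (rule suminf_near_1)
          fix k
          show "term3F2 x b c (1 + x - b) (1 + x - c) k \<ge> 0"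
            using assms x by (intro term3F2_nonneg) auto
          \<comment> \<open>From b \<le> 1 follows x \<le> 1 + x - b, so (1 + x - b)_k absorbs
            (x)_k; moreover (b)_k and (c)_k are at most k!. What survives is k! / (1 + x - c)_k, and
            1 + x - c serves as N.\<close>
          have "pochhammer x k * pochhammer b k * pochhammer c k \<le> pochhammer (1 + x - b) k * fact k * fact k"
            using assms x by (intro mult_mono pochhammer_mono pochhammer_le_fact mult_nonneg_nonneg pochhammer_nonneg) auto
          moreover have "pochhammer (1 + x - b) k > 0" "pochhammer (1 + x - c) k > 0"
            using assms x by (auto intro!: pochhammer_pos)
          ultimately show "term3F2 x b c (1 + x - b) (1 + x - c) k \<le> fact k / pochhammer (1 + x - c) k"
            unfolding term3F2_def by (simp add: divide_simps mult_ac)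
        qed (use assms x in auto)
        then show ?case by (simp add: x_def)
      qed
      show "(\<lambda>n. pi\<^sup>2 / (1 + (a + real (2 * n)) - c)) \<longlonglongrightarrow> 0"
        by real_asymp
    qed
    have double: "filterlim (\<lambda>n. 2 * n :: nat) sequentially sequentially"
      by (intro filterlim_subseq strict_monoI) auto
    \<comment> \<open>The eight Gamma values split into two balanced quadruples, one moving by n and
      one by 2n: (1 + a/2) + (1 + a/2 - b - c) = (1 + a/2 - b) + (1 + a/2 - c), and the same with a
      in place of a/2.\<close>
    have "(\<lambda>n. Gamma (1 + a / 2 + real n) * Gamma (1 + a / 2 - b - c + real n) /
           (Gamma (1 + a / 2 - b + real n) * Gamma (1 + a / 2 - c + real n)) *
           (Gamma (1 + a - b + real (2 * n)) * Gamma (1 + a - c + real (2 * n)) /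
            (Gamma (1 + a + real (2 * n)) * Gamma (1 + a - b - c + real (2 * n))))) \<longlonglongrightarrow> 1 * 1"
      using assms
      by (intro tendsto_mult Gamma_quotient_tendsto_1 filterlim_compose[OF Gamma_quotient_tendsto_1 double]) auto
    then show "(\<lambda>n. R (a + real (2 * n))) \<longlonglongrightarrow> 1"
      unfolding R_def by (simp add: add_divide_distrib algebra_simps)
  qed simp
  ultimately have "(\<lambda>n::nat. S a / R a) \<longlonglongrightarrow> 1"
    by simp
  then have "S a = R a"
    using R_pos[of a] by (simp add: LIMSEQ_const_iff)
  moreover have "term3F2 a b c (1 + a - b) (1 + a - c) sums S a"
    unfolding S_def using assms by (intro summable_sums summable_term3F2) auto
  ultimately show ?thesis
    by (simp add: R_def)
qed

text \<open>The pair a, 1 - a stays fixed while c, e and f move by 2, which preserves e + f = 1 +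
  2c. The closed form factors as Q(e) Q(f), so that its recurrence and its limit reduce to those of
  the single function \<open>Q\<close>.\<close>

lemma whipple_3F2:
  fixes a c e f :: real
  assumes "0 < a" "a < 1" "c > 0" "e > 0" "f > 0" and ef: "e + f = 1 + 2 * c"
  shows "term3F2 a (1 - a) c e f sums
    (Gamma (e / 2) * Gamma ((e + 1) / 2) * Gamma (f / 2) * Gamma ((f + 1) / 2) /
     (Gamma ((a + e) / 2) * Gamma ((1 - a + e) / 2) * Gamma ((a + f) / 2) * Gamma ((1 - a + f) / 2)))"
proof -
  define S where "S = (\<lambda>n. suminf (term3F2 (c + real (2 * n)) a (1 - a) (e + real (2 * n)) (f + real (2 * n))))"
  define Q where "Q = (\<lambda>e. Gamma (e / 2) * Gamma ((e + 1) / 2) / (Gamma ((a + e) / 2) * Gamma ((1 - a + e) / 2)))"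
  define R where "R = (\<lambda>n. Q (e + real (2 * n)) * Q (f + real (2 * n)))"
  have Q_pos: "Q x > 0" if "x > 0" for x
    unfolding Q_def using assms that by (intro divide_pos_pos mult_pos_pos Gamma_real_pos) auto
  have Q_step: "Q (x + 2) = x * (x + 1) / ((a + x) * (1 - a + x)) * Q x" if "x > 0" for x
  proof -
    have 1: "Gamma ((x + 2) / 2) = (x / 2) * Gamma (x / 2)"
      using assms that by (intro Gamma_add_1) (auto simp: field_simps)
    have 2: "Gamma ((x + 2 + 1) / 2) = ((x + 1) / 2) * Gamma ((x + 1) / 2)"
      using assms that by (intro Gamma_add_1) (auto simp: field_simps)
    have 3: "Gamma ((a + (x + 2)) / 2) = ((a + x) / 2) * Gamma ((a + x) / 2)"
      using assms that by (intro Gamma_add_1) (auto simp: field_simps)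
    have 4: "Gamma ((1 - a + (x + 2)) / 2) = ((1 - a + x) / 2) * Gamma ((1 - a + x) / 2)"
      using assms that by (intro Gamma_add_1) (auto simp: field_simps)
    show ?thesis
      unfolding Q_def 1 2 3 4 by (simp add: mult_ac)
  qed
  have step: "S n / R n = S (Suc n) / R (Suc n)" for n
  proof -
    define c' e' f' where "c' = c + real (2 * n)" and "e' = e + real (2 * n)" and "f' = f + real (2 * n)"
    have pos: "c' > 0" "e' > 0" "f' > 0" using assms by (auto simp: c'_def e'_def f'_def)
    have f': "1 + 2 * c' - e' = f'" using ef by (simp add: c'_def e'_def f'_def)
    have Suc: "c + real (2 * Suc n) = c' + 2" "e + real (2 * Suc n) = e' + 2" "f + real (2 * Suc n) = f' + 2"
      by (auto simp: c'_def e'_def f'_def)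
    define P where "P = (a + e') * (1 - a + e') * ((a + f') * (1 - a + f'))"
    have P: "P > 0" using assms pos by (simp add: P_def)
    define p where "p = (\<lambda>k. (e' - c') * (f' - c') / c' + ((e' - c') * (f' - c') - (1 + c' - a) * (a + c')) / (c' * (c' + 1)) * (c' + k)
                  + (- 1 / c') * ((c' + k) * (c' + k + 1)))"
    have p: "p k = (e' - c') * (f' - c') / c' + ((e' - c') * (f' - c') - (1 + c' - a) * (a + c')) / (c' * (c' + 1)) * (c' + k)
                  + (- 1 / c') * ((c' + k) * (c' + k + 1))" for k
      by (simp add: p_def)
    have nz: "c' \<noteq> 0" "c' + 1 \<noteq> 0" using pos by auto
    have "S n = P / (c' * (c' + 1)) * (c' * (c' + 1)) / ((e' * (e' + 1)) * (f' * (f' + 1))) * S (Suc n)"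
      unfolding S_def Suc P_def
      using suminf_term3F2_shift[OF _ _ _ _ _ _ p whipple_certificate[OF nz f'[symmetric] p]] assms pos f'
      by (simp add: c'_def e'_def f'_def mult.assoc)
    then have "S n = P / ((e' * (e' + 1)) * (f' * (f' + 1))) * S (Suc n)"
      using pos by simp
    moreover have "R (Suc n) = (e' * (e' + 1)) * (f' * (f' + 1)) / P * R n"
      unfolding R_def Suc Q_step[OF pos(2)] Q_step[OF pos(3)] P_def by (simp add: e'_def f'_def)
    ultimately show ?thesis
      using pos P by simp
  qed
  have "(\<lambda>n. S n / R n) = (\<lambda>n. S 0 / R 0)"
  proof
    show "S n / R n = S 0 / R 0" for n
      by (induction n) (use step in auto)
  qed
  moreover have "(\<lambda>n. S n / R n) \<longlonglongrightarrow> 1 / 1"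
  proof (intro tendsto_divide)
    define m where "m = min e f"
    show "S \<longlonglongrightarrow> 1"
    proof (rule LIM_zero_cancel, rule Lim_null_comparison)
      show "\<forall>\<^sub>F n in sequentially. norm (S n - 1) \<le> pi\<^sup>2 / (m + real (2 * n))"
        using eventually_ge_at_top[of 2]
      proof eventually_elim
        case (elim n)
        define c' e' f' where "c' = c + real (2 * n)" and "e' = e + real (2 * n)" and "f' = f + real (2 * n)"
        have pos: "c' > 0" "e' > 0" "f' > 0" using assms by (auto simp: c'_def e'_def f'_def)
        have "\<bar>S n - 1\<bar> \<le> pi\<^sup>2 / min e' f'"
          unfolding S_def c'_def[symmetric] e'_def[symmetric] f'_def[symmetric]
        proof (rule suminf_near_1)
          show "3 \<le> min e' f'" using elim assms by (simp add: e'_def f'_def)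
          fix k
          show "term3F2 c' a (1 - a) e' f' k \<ge> 0"
            using assms pos by (intro term3F2_nonneg) auto
          \<comment> \<open>As e' + f' = 1 + 2c', the larger of e' and f' dominates c' and absorbs
            its Pochhammer symbol; the smaller one is left over as N.\<close>
          have "c' \<le> e' \<or> c' \<le> f'" using ef by (auto simp: c'_def e'_def f'_def)
          then have "c' \<le> max e' f'" by auto
          then have "pochhammer c' k * pochhammer a k * pochhammer (1 - a) k * pochhammer (min e' f') k
              \<le> pochhammer (max e' f') k * fact k * fact k * pochhammer (min e' f') k"
            using assms pos by (intro mult_mono pochhammer_mono pochhammer_le_fact mult_nonneg_nonneg pochhammer_nonneg) auto
          moreover have "pochhammer (max e' f') k * pochhammer (min e' f') k = pochhammer e' k * pochhammer f' k"
            by (auto simp: max_def min_def)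
          ultimately have "pochhammer c' k * pochhammer a k * pochhammer (1 - a) k * pochhammer (min e' f') k
              \<le> fact k * (fact k * pochhammer e' k * pochhammer f' k)"
            by (simp add: mult_ac)
          moreover have "pochhammer e' k > 0" "pochhammer f' k > 0" "pochhammer (min e' f') k > 0"
            using pos by (auto intro!: pochhammer_pos)
          ultimately show "term3F2 c' a (1 - a) e' f' k \<le> fact k / pochhammer (min e' f') k"
            unfolding term3F2_def by (subst frac_le_eq) (auto simp: divide_simps)
        qed auto
        moreover have "min e' f' = m + real (2 * n)" by (simp add: m_def e'_def f'_def)
        ultimately show ?case by simp
      qed
      show "(\<lambda>n. pi\<^sup>2 / (m + real (2 * n))) \<longlonglongrightarrow> 0"
        by real_asymp
    qed
    have Q: "(\<lambda>n. Q (x + real (2 * n))) \<longlonglongrightarrow> 1" if "x > 0" for x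
    proof -
      have lim: "(\<lambda>n. Gamma (x / 2 + real n) * Gamma ((x + 1) / 2 + real n) /
             (Gamma ((a + x) / 2 + real n) * Gamma ((1 - a + x) / 2 + real n))) \<longlonglongrightarrow> 1"
        using assms that by (intro Gamma_quotient_tendsto_1) (auto simp: field_simps)
      have "(x + real (2 * n)) / 2 = x / 2 + real n"
        "(x + real (2 * n) + 1) / 2 = (x + 1) / 2 + real n"
        "(a + (x + real (2 * n))) / 2 = (a + x) / 2 + real n"
        "(1 - a + (x + real (2 * n))) / 2 = (1 - a + x) / 2 + real n" for n
        by (auto simp: field_simps)
      note shift = this
      show ?thesis
        unfolding Q_def shift by (rule lim)
    qed
    show "R \<longlonglongrightarrow> 1"
      unfolding R_def using tendsto_mult[OF Q Q, of e f] assms by simp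
  qed simp
  ultimately have "(\<lambda>n::nat. S 0 / R 0) \<longlonglongrightarrow> 1"
    by (simp only: div_by_1)
  moreover have "R 0 > 0" using assms by (simp add: R_def Q_pos)
  ultimately have "S 0 = R 0"
    by (simp add: LIMSEQ_const_iff)
  moreover have "term3F2 c a (1 - a) e f sums S 0"
    unfolding S_def using assms by (auto intro!: summable_sums summable_term3F2)
  \<comment> \<open>The series was treated with \<open>c\<close> first, the slot that is shifted;
    the term is symmetric in its upper parameters.\<close>
  moreover have "term3F2 c a (1 - a) e f = term3F2 a (1 - a) c e f"
    by (simp add: term3F2_def fun_eq_iff mult_ac)
  ultimately show ?thesis
    by (simp add: R_def Q_def mult_ac)
qed

subsection \<open>Termwise differentiation\<close>

text \<open>In product form the logarithmic derivative of a term is a sum over j < k, which is how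
  harmonic numbers arise.\<close>

lemma term3F2_prod:
  "term3F2 a b c d e k = (\<Prod>j<k. (a + real j) * (b + real j) * (c + real j) / ((1 + real j) * (d + real j) * (e + real j)))"
  by (induction k) (simp_all add: term3F2_Suc)

text \<open>Raabe's test: the limit 3/2 - 6\<delta> exceeds 1 exactly when \<delta> < 1/12. The
  bound 1/24 is half of this threshold and keeps the limit at 5/4 or more.\<close>

lemma summable_majorant:
  fixes \<delta> :: real
  assumes "0 < \<delta>" "\<delta> \<le> 1 / 24"
  shows "summable (\<lambda>k. \<Prod>j<k. (real j + 1 / 2 + \<delta>) ^ 3 / (real j + 1 - \<delta>) ^ 3)"
proof -
  define t where "t = (\<lambda>k. \<Prod>j<k. (real j + 1 / 2 + \<delta>) ^ 3 / (real j + 1 - \<delta>) ^ 3)"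
  have pos: "t k > 0" for k
    unfolding t_def using assms by (intro prod_pos ballI divide_pos_pos zero_less_power) auto
  have "(\<lambda>k. real k * (t k / t (Suc k) - 1)) = (\<lambda>k. real k * ((real k + 1 - \<delta>) ^ 3 / (real k + 1 / 2 + \<delta>) ^ 3 - 1))"
  proof
    fix k
    have "t (Suc k) = t k * ((real k + 1 / 2 + \<delta>) ^ 3 / (real k + 1 - \<delta>) ^ 3)"
      by (simp add: t_def)
    then show "real k * (t k / t (Suc k) - 1) = real k * ((real k + 1 - \<delta>) ^ 3 / (real k + 1 / 2 + \<delta>) ^ 3 - 1)"
      using pos[of k] by simp
  qed
  moreover have "(\<lambda>k. real k * ((real k + 1 - \<delta>) ^ 3 / (real k + 1 / 2 + \<delta>) ^ 3 - 1)) \<longlonglongrightarrow> 3 / 2 - 6 * \<delta>"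
    by real_asymp
  ultimately have "(\<lambda>k. ereal (real k * (t k / t (Suc k) - 1))) \<longlonglongrightarrow> ereal (3 / 2 - 6 * \<delta>)"
    unfolding lim_ereal by (simp only:)
  then have "liminf (\<lambda>k. ereal (real k * (t k / t (Suc k) - 1))) = ereal (3 / 2 - 6 * \<delta>)"
    by (intro lim_imp_Liminf) auto
  then have "summable t"
    using assms pos by (intro raabes_test_convergence) (auto simp: one_ereal_def)
  then show ?thesis
    by (simp add: t_def)
qed

text \<open>Each derivative is given as the value times \<open>l j\<close>, not as a quotient, so
  the product rule applies without any division by a factor.\<close>

lemma has_field_derivative_prod_log:
  fixes g :: "nat \<Rightarrow> complex \<Rightarrow> complex"
  assumes "\<And>j. j < k \<Longrightarrow> (g j has_field_derivative g j z * l j) (at z)"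
  shows "((\<lambda>w. \<Prod>j<k. g j w) has_field_derivative (\<Prod>j<k. g j z) * (\<Sum>j<k. l j)) (at z)"
  using assms
proof (induction k)
  case (Suc k)
  have "((\<lambda>w. (\<Prod>j<k. g j w) * g k w) has_field_derivative
      ((\<Prod>j<k. g j z) * (\<Sum>j<k. l j)) * g k z + (g k z * l k) * (\<Prod>j<k. g j z)) (at z)"
    by (intro DERIV_mult Suc) auto
  then show ?case
    by (simp add: algebra_simps)
qed simp

text \<open>
  With a complex parameter, a locally uniform bound on the terms already justifies differentiating
  termwise. The closed form \<open>F\<close> is only needed on one side of 0, so that the parameter can be
  the square of the actual perturbation. The terms decay like $k^{-3/2+6\delta}$.
\<close>

lemma sums_log_derivative:
  fixes N M :: "nat \<Rightarrow> complex \<Rightarrow> complex" and l :: "nat \<Rightarrow> real" and F :: "real \<Rightarrow> real"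
  assumes \<delta>: "0 < \<delta>" "\<delta> \<le> 1 / 24"
    and holo: "\<And>j. N j holomorphic_on ball 0 \<delta>" "\<And>j. M j holomorphic_on ball 0 \<delta>"
    and upper: "\<And>j w. norm w < \<delta> \<Longrightarrow> norm (N j w) \<le> (real j + 1 / 2 + \<delta>) ^ 3"
    and lower: "\<And>j w. norm w < \<delta> \<Longrightarrow> (real j + 1 - \<delta>) ^ 3 \<le> norm (M j w)"
    and log: "\<And>j. ((\<lambda>w. N j w / M j w) has_field_derivative N j 0 / M j 0 * of_real (l j)) (at 0)"
    and sums: "\<And>x. 0 \<le> x \<Longrightarrow> x < \<delta> \<Longrightarrow>
      (\<lambda>k. \<Prod>j<k. N j (of_real x) / M j (of_real x)) sums of_real (F x)"
    and F: "(F has_field_derivative D) (at 0 within {0..})"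
  shows "(\<lambda>k. (\<Prod>j<k. N j 0 / M j 0) * (\<Sum>j<k. of_real (l j))) sums of_real D"
proof -
  define f where "f = (\<lambda>k w. \<Prod>j<k. N j w / M j w)"
  have M_nz: "M j w \<noteq> 0" if "norm w < \<delta>" for j w
  proof -
    have "0 < (real j + 1 - \<delta>) ^ 3" using \<delta> by (intro zero_less_power) auto
    then show ?thesis using lower[OF that, of j] by auto
  qed
  have "f k holomorphic_on ball 0 \<delta>" for k
    unfolding f_def using M_nz by (intro holomorphic_intros holo) auto
  then have f_deriv: "(f k has_field_derivative deriv (f k) w) (at w)" if "w \<in> ball 0 \<delta>" for k w
    using that holomorphic_derivI by blast
  have f_bound: "norm (f k w) \<le> (\<Prod>j<k. (real j + 1 / 2 + \<delta>) ^ 3 / (real j + 1 - \<delta>) ^ 3)" if "norm w < \<delta>" for k w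
    unfolding f_def prod_norm[symmetric] norm_divide
    using \<delta> upper[OF that] lower[OF that] by (intro prod_mono conjI frac_le) auto
  have ex: "\<exists>g g'. \<forall>w\<in>ball 0 \<delta>. (\<lambda>k. f k w) sums g w \<and> (\<lambda>k. deriv (f k) w) sums g' w \<and>
      (g has_field_derivative g' w) (at w)"
  proof (rule series_and_derivative_comparison_complex
      [where f = f and f' = "\<lambda>k. deriv (f k)", OF open_ball f_deriv])
    fix w :: complex assume "w \<in> ball 0 \<delta>"
    \<comment> \<open>The majorant holds on the whole disc, so the radius 1 is an arbitrary choice.
      It is embedded into the complex numbers to fit the comparison theorem.\<close>
    show "\<exists>d h. 0 < d \<and> summable h \<and> range h \<subseteq> \<real>\<^sub>\<ge>\<^sub>0 \<and>
        (\<forall>\<^sub>F n in sequentially. \<forall>y\<in>ball w d \<inter> ball 0 \<delta>. norm (f n y) \<le> cmod (h n))"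
    proof -
      define h where "h k = (\<Prod>j<k. (real j + 1 / 2 + \<delta>) ^ 3 / (real j + 1 - \<delta>) ^ 3)" for k
      have nonneg: "h k \<ge> 0" for k
        unfolding h_def using \<delta> by (intro prod_nonneg) auto
      have "summable (\<lambda>k. complex_of_real (h k))"
        unfolding summable_of_real_iff h_def by (rule summable_majorant[OF \<delta>])
      moreover have "range (\<lambda>k. complex_of_real (h k)) \<subseteq> \<real>\<^sub>\<ge>\<^sub>0"
        using nonneg by auto
      moreover have "\<forall>\<^sub>F n in sequentially. \<forall>y\<in>ball w 1 \<inter> ball 0 \<delta>. norm (f n y) \<le> norm (complex_of_real (h n))"
        using f_bound[folded h_def] nonneg by (intro always_eventually) auto
      ultimately show ?thesis
        by (intro exI[of _ "1::real"] exI[of _ "\<lambda>k. complex_of_real (h k)"] conjI) simp_all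
    qed
  qed
  obtain g and g' :: "complex \<Rightarrow> complex" where g: "\<And>w. norm w < \<delta> \<Longrightarrow> (\<lambda>k. f k w) sums g w"
    and g': "(\<lambda>k. deriv (f k) 0) sums g' 0" "(g has_field_derivative g' 0) (at 0)"
  proof -
    obtain g g' where *: "\<And>w. w \<in> ball 0 \<delta> \<Longrightarrow> (\<lambda>k. f k w) sums g w \<and>
        (\<lambda>k. deriv (f k) w) sums g' w \<and> (g has_field_derivative g' w) (at w)"
      using ex by blast
    show thesis
      by (rule that[of g g']) (use * \<delta> in auto)
  qed
  have "deriv (f k) 0 = (\<Prod>j<k. N j 0 / M j 0) * (\<Sum>j<k. of_real (l j))" for k
    unfolding f_def by (intro DERIV_imp_deriv has_field_derivative_prod_log log)
  \<comment> \<open>The closed form agrees with the complex sum \<open>g\<close> on [0, \<delta>)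
    only. Since 0 is a limit point of this interval, the one-sided derivative there already
    determines the complex derivative.\<close>
  moreover have "g' 0 = of_real D"
  proof -
    have g_real: "g (of_real x) = of_real (F x)" if "x \<in> {0..<\<delta>}" for x
    proof (rule sums_unique2)
      show "(\<lambda>k. f k (of_real x)) sums g (of_real x)" using that by (intro g) auto
      show "(\<lambda>k. f k (of_real x)) sums of_real (F x)" unfolding f_def using that by (intro sums) auto
    qed
    have 1: "((\<lambda>x. complex_of_real (F x)) has_vector_derivative of_real D) (at 0 within {0..<\<delta>})"
      using has_field_derivative_subset[OF F, of "{0..<\<delta>}"]
      by (intro has_vector_derivative_of_real)
        (auto simp: subset_iff simp flip: has_real_derivative_iff_has_vector_derivative)
    have "((\<lambda>x. g (of_real x)) has_vector_derivative g' 0) (at 0 within {0..<\<delta>})"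
      using g'(2) by (intro has_vector_derivative_real_field) simp
    then have 2: "((\<lambda>x. of_real (F x)) has_vector_derivative g' 0) (at 0 within {0..<\<delta>})"
      by (rule has_vector_derivative_transform[rotated 2]) (use g_real \<delta> in auto)
    have "{0..<\<delta>} - {0} = {0<..<\<delta>}" by auto
    then have "at 0 within {0..<\<delta>} \<noteq> bot"
      using \<delta> by (simp add: at_within_eq_bot_iff)
    then show ?thesis
      using vector_derivative_unique_within[OF _ 2 1] by blast
  qed
  ultimately show ?thesis
    using g'(1) by simp
qed

text \<open>The product Gamma(c + s) Gamma(c - s) is even in s and expands as Gamma(c)^2 (1 +
  psi'(c) s^2 + ...), so psi'(c) is its logarithmic derivative in x = s^2. The chain rule breaks
  down at 0, where sqrt is not differentiable; l'Hopital's rule for (E(s) - E(0)) / s^2 takes its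
  place.\<close>

lemma has_field_derivative_Gamma_symmetric:
  fixes c :: real
  assumes c: "c > 0"
  shows "((\<lambda>x. Gamma (c + sqrt x) * Gamma (c - sqrt x)) has_field_derivative (Gamma c)\<^sup>2 * Polygamma 1 c)
           (at 0 within {0..})"
proof -
  define E where "E = (\<lambda>s. Gamma (c + s) * Gamma (c - s))"
  have ev: "\<forall>\<^sub>F s in at_right 0. 0 < s \<and> s < c"
    using c eventually_at_right_less[of 0] eventually_at_right_real[of 0 c] by (auto elim: eventually_elim2)
  have not_int: "x \<notin> \<int>\<^sub>\<le>\<^sub>0" if "x > 0" for x :: real
    using that by (auto elim!: nonpos_Ints_cases)
  have E_deriv: "(E has_real_derivative E s * (Digamma (c + s) - Digamma (c - s))) (at s)" if "\<bar>s\<bar> < c" for s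
  proof -
    have "((\<lambda>s. Gamma (c + s)) has_real_derivative Gamma (c + s) * Digamma (c + s)) (at s)"
      using that by (auto intro!: derivative_eq_intros not_int)
    moreover have "((\<lambda>s. Gamma (c - s)) has_real_derivative - Gamma (c - s) * Digamma (c - s)) (at s)"
      using that by (auto intro!: derivative_eq_intros not_int)
    ultimately show ?thesis
      unfolding E_def by (rule DERIV_cong[OF DERIV_mult]) (simp add: algebra_simps)
  qed
  have "((\<lambda>s. (E s - E 0) / s\<^sup>2) \<longlongrightarrow> E 0 * Polygamma 1 c) (at_right 0)"
  proof (rule lhopital_right_0)
    have "isCont E 0" using DERIV_isCont[OF E_deriv[of 0]] c by simp
    then have E_lim: "(E \<longlongrightarrow> E 0) (at_right 0)"
      by (auto simp: isCont_def intro: filterlim_mono at_le)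
    then show "((\<lambda>s. E s - E 0) \<longlongrightarrow> 0) (at_right 0)"
      by (simp add: LIM_zero)
    show "((\<lambda>s::real. s\<^sup>2) \<longlongrightarrow> 0) (at_right 0)"
      by (auto intro!: tendsto_eq_intros)
    show "\<forall>\<^sub>F s in at_right 0. (s::real)\<^sup>2 \<noteq> 0" "\<forall>\<^sub>F s in at_right 0. 2 * s \<noteq> (0::real)"
      using ev by (auto elim: eventually_mono)
    show "\<forall>\<^sub>F s in at_right 0. ((\<lambda>s. E s - E 0) has_real_derivative E s * (Digamma (c + s) - Digamma (c - s))) (at s)"
      using ev by eventually_elim (auto intro!: derivative_eq_intros E_deriv)
    show "\<forall>\<^sub>F s in at_right 0. ((\<lambda>s. s\<^sup>2) has_real_derivative 2 * s) (at s)"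
      by (auto intro!: always_eventually derivative_eq_intros)
    have "((\<lambda>s. Digamma (c + s) - Digamma (c - s)) has_real_derivative 2 * Polygamma 1 c) (at 0)"
    proof -
      have "((\<lambda>s. Digamma (c + s)) has_real_derivative Polygamma 1 c) (at 0)"
        using c by (auto intro!: derivative_eq_intros not_int)
      moreover have "((\<lambda>s. Digamma (c - s)) has_real_derivative - Polygamma 1 c) (at 0)"
        using c by (auto intro!: derivative_eq_intros not_int)
      ultimately show ?thesis
        by (rule DERIV_cong[OF DERIV_diff]) simp
    qed
    then have "((\<lambda>s. (Digamma (c + s) - Digamma (c - s)) / s) \<longlongrightarrow> 2 * Polygamma 1 c) (at_right 0)"
      by (auto simp: DERIV_def intro: filterlim_mono at_le)
    from tendsto_mult[OF E_lim tendsto_divide[OF this tendsto_const[of 2]]]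
    show "((\<lambda>s. E s * (Digamma (c + s) - Digamma (c - s)) / (2 * s)) \<longlongrightarrow> E 0 * Polygamma 1 c) (at_right 0)"
      by (simp add: mult_ac)
  qed
  moreover have "filterlim sqrt (at_right 0) (at_right 0)"
    unfolding filterlim_at using eventually_at_right_less[of 0]
    by (auto intro!: tendsto_eq_intros elim: eventually_mono)
  ultimately have "((\<lambda>x. (E (sqrt x) - E 0) / (sqrt x)\<^sup>2) \<longlongrightarrow> E 0 * Polygamma 1 c) (at_right 0)"
    by (rule filterlim_compose)
  moreover have "\<forall>\<^sub>F x in at_right 0. (E (sqrt x) - E 0) / (sqrt x)\<^sup>2 = (E (sqrt x) - E (sqrt 0)) / (x - 0)"
    using eventually_at_right_less[of 0] by eventually_elim simp
  ultimately have "((\<lambda>x. (E (sqrt x) - E (sqrt 0)) / (x - 0)) \<longlongrightarrow> E 0 * Polygamma 1 c) (at_right 0)"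
    by (rule Lim_transform_eventually)
  then show ?thesis
    by (simp add: has_field_derivative_iff at_within_Ici_at_right E_def power2_eq_square)
qed

subsection \<open>Special values\<close>

lemma sums_Polygamma_1:
  fixes z :: real
  assumes "z > 0"
  shows "(\<lambda>k. 1 / (z + real k)\<^sup>2) sums Polygamma 1 z"
proof -
  have "summable (\<lambda>k. inverse ((z + real k) ^ 2))"
    using assms by (intro Polygamma_converges') auto
  then show ?thesis
    by (simp add: Polygamma_def summable_sums power2_eq_square inverse_eq_divide)
qed

lemma Polygamma_1_1: "Polygamma 1 (1 :: real) = pi\<^sup>2 / 6"
  using sums_unique2[OF sums_Polygamma_1[of 1]] inverse_squares_sums by (simp add: add_ac)

lemma sums_pairs:
  fixes f :: "nat \<Rightarrow> real"
  assumes "f sums s"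
  shows "(\<lambda>k. f (2 * k) + f (2 * k + 1)) sums s"
proof -
  have "{k * 2..<k * 2 + 2} = {2 * k, 2 * k + 1}" for k :: nat by auto
  then show ?thesis
    using sums_group[OF assms, of 2] by simp
qed

text \<open>psi'(3/4) is 16 times the sum of 1 / (4k + 3)^2. The reciprocal odd squares sum to pi^2
  / 8 and their alternating version to G; the difference retains exactly the terms 1 / (4k + 3)^2,
  each twice.\<close>

lemma Polygamma_1_three_quarters: "Polygamma 1 (3 / 4 :: real) = pi\<^sup>2 - 8 * Catalan_const"
proof -
  have all: "(\<lambda>k. 1 / (real k + 1)\<^sup>2) sums (pi\<^sup>2 / 6)"
    using inverse_squares_sums by (simp add: add_ac)
  have "(\<lambda>k. 1 / (real (2 * k) + 1)\<^sup>2 + 1 / (real (2 * k + 1) + 1)\<^sup>2 - 1 / 4 * (1 / (real k + 1)\<^sup>2))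
          sums (pi\<^sup>2 / 6 - 1 / 4 * (pi\<^sup>2 / 6))"
    by (intro sums_diff sums_mult all sums_pairs[OF all])
  moreover have "1 / (real (2 * k + 1) + 1)\<^sup>2 = 1 / 4 * (1 / (real k + 1)\<^sup>2)" for k
  proof -
    have "(real (2 * k + 1) + 1)\<^sup>2 = 4 * (real k + 1)\<^sup>2"
      by (simp add: power2_eq_square algebra_simps)
    then show ?thesis by simp
  qed
  ultimately have odd: "(\<lambda>k. 1 / (2 * real k + 1)\<^sup>2) sums (pi\<^sup>2 / 8)"
    by simp
  have "(\<lambda>k. 8 * ((1 / (2 * real (2 * k) + 1)\<^sup>2 + 1 / (2 * real (2 * k + 1) + 1)\<^sup>2) -
       ((-1) ^ (2 * k) / (2 * real (2 * k) + 1)\<^sup>2 + (-1) ^ (2 * k + 1) / (2 * real (2 * k + 1) + 1)\<^sup>2)))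
     sums (8 * (pi\<^sup>2 / 8 - Catalan_const))"
    by (intro sums_mult sums_diff sums_pairs[OF odd] sums_pairs[OF Catalan_const_sums])
  moreover have "16 / (2 * real (2 * k + 1) + 1)\<^sup>2 = 1 / (3 / 4 + real k)\<^sup>2" for k
  proof -
    have "(2 * real (2 * k + 1) + 1)\<^sup>2 = 16 * (3 / 4 + real k)\<^sup>2"
      by (simp add: power2_eq_square algebra_simps)
    then show ?thesis by simp
  qed
  ultimately have "(\<lambda>k. 1 / (3 / 4 + real k)\<^sup>2) sums (pi\<^sup>2 - 8 * Catalan_const)"
    by simp
  then show ?thesis
    using sums_unique2 sums_Polygamma_1[of "3 / 4"] by force
qed

text \<open>In the difference of the two Digamma series the Euler constant and the terms 1 / (k + 1)
  cancel; what remains is 4 times the Leibniz series for pi / 4, grouped in pairs.\<close>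

lemma Digamma_three_quarters_minus_one_quarter:
  "Digamma (3 / 4 :: real) - Digamma (1 / 4) = pi"
proof -
  have "summable (\<lambda>k. (-1) ^ k * (1 / real (k * 2 + 1)))"
    using summable_arctan_series[of 1] by simp
  moreover have "pi / 4 = (\<Sum>k. (-1) ^ k * (1 / real (k * 2 + 1)))"
    using pi_series by simp
  ultimately have "(\<lambda>k. (-1) ^ k * (1 / real (k * 2 + 1))) sums (pi / 4)"
    by (simp only: summable_sums)
  then have "(\<lambda>k. 4 * ((-1) ^ (2 * k) * (1 / real (2 * k * 2 + 1)) +
      (-1) ^ (2 * k + 1) * (1 / real ((2 * k + 1) * 2 + 1)))) sums (4 * (pi / 4))"
    by (intro sums_mult sums_pairs)
  moreover have "4 * ((-1) ^ (2 * k) * (1 / real (2 * k * 2 + 1)) +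
      (-1) ^ (2 * k + 1) * (1 / real ((2 * k + 1) * 2 + 1))) =
      inverse (1 / 4 + real k) - inverse (3 / 4 + real k)" for k
    by (simp add: divide_simps) (simp add: algebra_simps)
  ultimately have "(\<lambda>k. inverse (1 / 4 + real k) - inverse (3 / 4 + real k)) sums pi"
    by simp
  moreover have "(\<lambda>k. (inverse (real (Suc k)) - inverse (3 / 4 + real k)) -
       (inverse (real (Suc k)) - inverse (1 / 4 + real k))) sums
       ((Digamma (3 / 4 :: real) + euler_mascheroni) - (Digamma (1 / 4) + euler_mascheroni))"
    unfolding Digamma_def diff_add_cancel
    by (intro sums_diff summable_sums summable_Digamma) auto
  ultimately show ?thesis
    using sums_unique2 by force
qed

section \<open>Logarithmic derivatives of Gamma products\<close>

lemma log_derivative_mult: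
  fixes f g :: "real \<Rightarrow> real"
  assumes "(f has_field_derivative f x * a) (at x within S)" "(g has_field_derivative g x * b) (at x within S)"
  shows "((\<lambda>x. f x * g x) has_field_derivative (f x * g x) * (a + b)) (at x within S)"
  using DERIV_mult[OF assms] by (simp add: algebra_simps)

lemma log_derivative_divide:
  fixes f g :: "real \<Rightarrow> real"
  assumes "(f has_field_derivative f x * a) (at x within S)" "(g has_field_derivative g x * b) (at x within S)"
    and "g x \<noteq> 0"
  shows "((\<lambda>x. f x / g x) has_field_derivative (f x / g x) * (a - b)) (at x within S)"
  by (rule DERIV_cong[OF DERIV_divide[OF assms]]) (use assms(3) in \<open>simp add: field_simps\<close>)

lemma log_derivative_const: "((\<lambda>x. c) has_field_derivative c * 0) (at x within S)" for c :: real
  by simp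

text \<open>The value is left as \<open>Gamma (c + s * 0)\<close> so that the conclusion has
  literally the form "value at 0 times logarithmic derivative" on which the rules for products and
  quotients compose.\<close>

lemma log_derivative_Gamma:
  fixes c :: real
  assumes "c > 0"
  shows "((\<lambda>x. Gamma (c + s * x)) has_field_derivative Gamma (c + s * 0) * (s * Digamma c)) (at 0 within S)"
  using assms by (auto intro!: derivative_eq_intros elim!: nonpos_Ints_cases)

text \<open>Since r sqrt x = sqrt (r^2 x), this is the case r = 1 with x rescaled by r^2, which
  accounts for the factor r^2.\<close>

lemma log_derivative_Gamma_symmetric:
  fixes c r :: real
  assumes "c > 0" "r \<ge> 0"
  shows "((\<lambda>x. Gamma (c - r * sqrt x) * Gamma (c + r * sqrt x)) has_field_derivative
    (Gamma (c - r * sqrt 0) * Gamma (c + r * sqrt 0)) * (r\<^sup>2 * Polygamma 1 c)) (at 0 within {0..})"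
proof -
  have "((\<lambda>x. Gamma (c + sqrt x) * Gamma (c - sqrt x)) has_field_derivative (Gamma c)\<^sup>2 * Polygamma 1 c)
      (at (r\<^sup>2 * 0) within (*) (r\<^sup>2) ` {0..})"
    using has_field_derivative_Gamma_symmetric[OF assms(1)] by (auto intro: has_field_derivative_subset)
  moreover have "((*) (r\<^sup>2) has_field_derivative r\<^sup>2) (at 0 within {0..})"
    by (auto intro!: derivative_eq_intros)
  ultimately have "((\<lambda>x. Gamma (c + sqrt x) * Gamma (c - sqrt x)) \<circ> (*) (r\<^sup>2) has_field_derivative
      (Gamma c)\<^sup>2 * Polygamma 1 c * r\<^sup>2) (at 0 within {0..})"
    by (rule DERIV_image_chain)
  then show ?thesis
    using assms(2) by (simp add: o_def real_sqrt_mult power2_eq_square mult_ac)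
qed

lemma Gamma_real_nonzero: "Gamma x \<noteq> 0" if "x > 0" for x :: real
  using Gamma_real_pos[OF that] by simp

lemmas log_derivative_intros = log_derivative_mult log_derivative_divide log_derivative_const log_derivative_Gamma

lemma central_binomial_cubed:
  "real ((2 * k) choose k) ^ 3 / 64 ^ k = (\<Prod>j<k. (real j + 1 / 2) ^ 3 / (real j + 1) ^ 3)"
proof (induction k)
  case (Suc k)
  have "real ((2 * Suc k) choose (Suc k)) = real ((2 * k) choose k) * (4 * ((real k + 1 / 2) / (real k + 1)))"
  proof -
    have "real ((2 * n) choose n) = fact (2 * n) / (fact n)\<^sup>2" for n
      by (simp add: binomial_fact power2_eq_square)
    moreover have "(fact (2 * Suc k) :: real) = 2 * (real k + 1) * (2 * real k + 1) * fact (2 * k)"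
      by (simp add: algebra_simps)
    moreover have "f / ((real k + 1) * g)\<^sup>2 * (2 * (real k + 1) * (2 * real k + 1)) =
        f / g\<^sup>2 * (4 * ((real k + 1 / 2) / (real k + 1)))" if "g \<noteq> 0" for f g
      using that by (simp add: divide_simps power2_eq_square) (simp add: algebra_simps)
    from this[of "fact k" "fact (2 * k)"]
    have "2 * (real k + 1) * (2 * real k + 1) * fact (2 * k) / (fact (Suc k))\<^sup>2 =
        fact (2 * k) / (fact k)\<^sup>2 * (4 * ((real k + 1 / 2) / (real k + 1)))"
      by (simp add: mult_ac add_ac)
    ultimately show ?thesis
      by (simp only:)
  qed
  then have "real ((2 * Suc k) choose (Suc k)) ^ 3 / 64 ^ Suc k =
      real ((2 * k) choose k) ^ 3 / 64 ^ k * ((real k + 1 / 2) ^ 3 / (real k + 1) ^ 3)"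
    by (simp only: power_mult_distrib power_divide) simp
  then show ?case
    by (simp only: Suc.IH prod.lessThan_Suc)
qed simp

lemma gen_harm_altdef: "gen_harm r k = (\<Sum>j<k. 1 / (real j + 1) ^ r)"
  unfolding gen_harm_def by (simp add: sum.atLeast1_atMost_eq add.commute)

lemma odd_harm_altdef: "2 ^ r * odd_harm r k = (\<Sum>j<k. 1 / (real j + 1 / 2) ^ r)"
proof -
  have "2 ^ r * (1 / (2 * real (Suc j) - 1) ^ r) = 1 / (real j + 1 / 2) ^ r" for j
  proof -
    have "2 * real (Suc j) - 1 = 2 * (real j + 1 / 2)" by simp
    then show ?thesis by (simp only: power_mult_distrib) simp
  qed
  then show ?thesis
    unfolding odd_harm_def by (simp only: One_nat_def sum.atLeast1_atMost_eq sum_distrib_left)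
qed

text \<open>The left side is the common value at 0 of the three Dixon closed forms. The reflection
  formula Gamma(1/4) Gamma(3/4) = pi sqrt 2 eliminates Gamma(1/4).\<close>

lemma Gamma_quotient_base_value:
  "Gamma (5 / 4 :: real) * Gamma (1 / 4) / (Gamma (3 / 2) * Gamma (1 / 2) * (Gamma (3 / 4))\<^sup>2) =
   pi / Gamma (3 / 4) ^ 4"
proof -
  have "Gamma (1 / 4 :: real) * Gamma (3 / 4) = pi / sin (pi / 4)"
  proof -
    have "complex_of_real (Gamma (1 / 4) * Gamma (1 - 1 / 4)) = complex_of_real (pi / sin (pi * (1 / 4)))"
    proof -
      have "complex_of_real (1 - 1 / 4) = 1 - of_real (1 / 4)"
        "complex_of_real pi * of_real (1 / 4) = of_real (pi * (1 / 4))"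
        by simp_all
      then show ?thesis
        using Gamma_reflection_complex[of "of_real (1 / 4)"]
        by (simp only: of_real_mult[symmetric] Gamma_complex_of_real sin_of_real of_real_divide)
          (simp only: of_real_mult of_real_divide Gamma_complex_of_real[symmetric])
    qed
    then show ?thesis
      by (subst (asm) of_real_eq_iff) simp
  qed
  also have "\<dots> = pi * (2 / sqrt 2)"
    by (simp add: sin_45)
  also have "2 / sqrt 2 = sqrt 2"
    by (rule real_div_sqrt) simp
  finally have refl: "Gamma (1 / 4 :: real) * Gamma (3 / 4) = pi * sqrt 2" .
  have pos: "Gamma (3 / 4 :: real) > 0" by (intro Gamma_real_pos) auto
  have quarter: "Gamma (1 / 4 :: real) = pi * sqrt 2 / Gamma (3 / 4)"
    using refl pos by (subst nonzero_eq_divide_eq) auto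
  have shift: "Gamma (5 / 4 :: real) = 1 / 4 * Gamma (1 / 4)" "Gamma (3 / 2 :: real) = 1 / 2 * Gamma (1 / 2)"
    by (intro Gamma_add_1; simp)+
  have "1 / 4 * (pi * s / g) * (pi * s / g) / (1 / 2 * r * r * g\<^sup>2) = (s * s) * (pi * pi) / (2 * (r * r) * g ^ 4)"
    for r s g :: real
    by (simp add: power2_eq_square power4_eq_xxxx mult_ac)
  from this[of "sqrt 2" "Gamma (3 / 4)" "sqrt pi"] show ?thesis
    unfolding shift quarter Gamma_one_half_real by simp
qed

lemma sums_eq_trans: "f sums a \<Longrightarrow> a = b \<Longrightarrow> f sums b"
  by simp

subsection \<open>The perturbed summations\<close>

text \<open>Fixes the radius 1/24 and the base point at which each factor is ((j + 1/2) / (j +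
  1))^3, and brings the conclusion back to real series, so that a perturbation is described by its
  factors and its closed form.\<close>

lemma sums_weighted_log_derivative:
  fixes N M :: "nat \<Rightarrow> complex \<Rightarrow> complex" and l :: "nat \<Rightarrow> real" and F :: "real \<Rightarrow> real"
    and t :: "real \<Rightarrow> nat \<Rightarrow> real"
  assumes holo: "\<And>j. N j holomorphic_on ball 0 (1 / 24)" "\<And>j. M j holomorphic_on ball 0 (1 / 24)"
    and upper: "\<And>j w. norm w < 1 / 24 \<Longrightarrow> norm (N j w) \<le> (real j + 1 / 2 + 1 / 24) ^ 3"
    and lower: "\<And>j w. norm w < 1 / 24 \<Longrightarrow> (real j + 1 - 1 / 24) ^ 3 \<le> norm (M j w)"
    and at_0: "\<And>j. N j 0 = of_real ((real j + 1 / 2) ^ 3)" "\<And>j. M j 0 = of_real ((real j + 1) ^ 3)"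
    and log: "\<And>j. ((\<lambda>w. N j w / M j w) has_field_derivative N j 0 / M j 0 * of_real (l j)) (at 0)"
    and t: "\<And>x k. 0 \<le> x \<Longrightarrow> x < 1 / 24 \<Longrightarrow>
      complex_of_real (t x k) = (\<Prod>j<k. N j (of_real x) / M j (of_real x))"
    and sums: "\<And>x. 0 \<le> x \<Longrightarrow> x < 1 / 24 \<Longrightarrow> t x sums F x"
    and F: "(F has_field_derivative D) (at 0 within {0..})"
  shows "(\<lambda>k. real ((2 * k) choose k) ^ 3 / 64 ^ k * (\<Sum>j<k. l j)) sums D"
proof -
  have "(\<lambda>k. (\<Prod>j<k. N j 0 / M j 0) * (\<Sum>j<k. of_real (l j))) sums complex_of_real D"
  proof (rule sums_log_derivative[OF _ _ holo upper lower log _ F])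
    show "(\<lambda>k. \<Prod>j<k. N j (of_real x) / M j (of_real x)) sums complex_of_real (F x)"
      if "0 \<le> x" "x < 1 / 24" for x
      unfolding t[OF that, symmetric] by (rule sums_of_real[OF sums[OF that]])
  qed auto
  also have "(\<lambda>k. (\<Prod>j<k. N j 0 / M j 0) * (\<Sum>j<k. of_real (l j))) =
      (\<lambda>k. complex_of_real (real ((2 * k) choose k) ^ 3 / 64 ^ k * (\<Sum>j<k. l j)))"
    unfolding central_binomial_cubed at_0 by (simp only: of_real_prod of_real_sum of_real_mult of_real_divide)
  finally show ?thesis
    unfolding sums_of_real_iff .
qed

section \<open>Bounds for the perturbed factors on the disc of radius 1/24\<close>

lemma norm_le_linear:
  assumes "norm w < 1 / 24" "p \<ge> 0"
  shows "norm (of_real p + w :: complex) \<le> p + 1 / 24" "p - 1 / 24 \<le> norm (of_real p + w :: complex)"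
  using norm_triangle_ineq[of "of_real p" w] norm_diff_ineq[of "of_real p" w] assms by auto

text \<open>A pair (p + s) (p - s) enters as p^2 - w with w = s^2. Bounding its two factors
  separately would cost |s|, up to sqrt (1/24); taken together they cost only 1/24, which is at most
  2p/24 because p \<ge> 1/2.\<close>

lemma norm_le_quadratic:
  assumes "norm w < 1 / 24" "p \<ge> 1 / 2"
  shows "norm ((of_real p)\<^sup>2 - w :: complex) \<le> (p + 1 / 24)\<^sup>2"
proof -
  have "norm ((of_real p)\<^sup>2 - w :: complex) \<le> p\<^sup>2 + 1 / 24"
    using norm_triangle_ineq4[of "(of_real p)\<^sup>2" w] assms by (simp add: norm_power)
  also have "\<dots> \<le> (p + 1 / 24)\<^sup>2"
    using assms(2) by (simp add: power2_eq_square algebra_simps)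
  finally show ?thesis .
qed

lemma norm_ge_quadratic:
  assumes "norm w < 1 / 24" "p \<ge> 1"
  shows "(p - 1 / 24)\<^sup>2 \<le> norm ((of_real p)\<^sup>2 - w :: complex)"
proof -
  have "(p - 1 / 24)\<^sup>2 \<le> p\<^sup>2 - 1 / 24"
    using assms(2) by (simp add: power2_eq_square algebra_simps)
  also have "\<dots> \<le> norm ((of_real p)\<^sup>2 - w :: complex)"
    using norm_triangle_ineq2[of "(of_real p)\<^sup>2" w] assms by (simp add: norm_power)
  finally show ?thesis .
qed

lemma norm_numerator_bounds:
  assumes "norm w < 1 / 24" "p \<ge> 1 / 2"
  shows "norm (of_real p * of_real p * (of_real p + w) :: complex) \<le> (p + 1 / 24) ^ 3"
    "norm (of_real p * ((of_real p)\<^sup>2 - w) :: complex) \<le> (p + 1 / 24) ^ 3"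
proof -
  show "norm (of_real p * of_real p * (of_real p + w) :: complex) \<le> (p + 1 / 24) ^ 3"
    unfolding norm_mult power3_eq_cube using assms
    by (intro mult_mono norm_le_linear) auto
  have "norm (of_real p * ((of_real p)\<^sup>2 - w) :: complex) \<le> (p + 1 / 24) * (p + 1 / 24)\<^sup>2"
    unfolding norm_mult using assms
    by (intro mult_mono norm_le_quadratic) auto
  then show "norm (of_real p * ((of_real p)\<^sup>2 - w) :: complex) \<le> (p + 1 / 24) ^ 3"
    by (simp add: power2_eq_square power3_eq_cube mult.assoc)
qed

lemma norm_denominator_bounds:
  assumes "norm w < 1 / 24" "q \<ge> 1"
  shows "(q - 1 / 24) ^ 3 \<le> norm (of_real q * of_real q * (of_real q - w) :: complex)"
    "(q - 1 / 24) ^ 3 \<le> norm (of_real q * (of_real q + w) * (of_real q + w) :: complex)"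
    "(q - 1 / 24) ^ 3 \<le> norm (of_real q * ((of_real q)\<^sup>2 - w) :: complex)"
    "(q - 1 / 24) ^ 3 \<le> norm (of_real q * of_real q * of_real q :: complex)"
proof -
  have "q - 1 / 24 \<le> norm (of_real q - w :: complex)"
    using norm_le_linear(2)[of "- w" q] assms by simp
  then show "(q - 1 / 24) ^ 3 \<le> norm (of_real q * of_real q * (of_real q - w) :: complex)"
    unfolding norm_mult power3_eq_cube using assms by (intro mult_mono) auto
  show "(q - 1 / 24) ^ 3 \<le> norm (of_real q * (of_real q + w) * (of_real q + w) :: complex)"
    unfolding norm_mult power3_eq_cube using assms by (intro mult_mono norm_le_linear) auto
  have "(q - 1 / 24) * (q - 1 / 24)\<^sup>2 \<le> norm (of_real q * ((of_real q)\<^sup>2 - w) :: complex)"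
    unfolding norm_mult using assms
    by (intro mult_mono norm_ge_quadratic) auto
  then show "(q - 1 / 24) ^ 3 \<le> norm (of_real q * ((of_real q)\<^sup>2 - w) :: complex)"
    by (simp add: power2_eq_square power3_eq_cube mult.assoc)
  show "(q - 1 / 24) ^ 3 \<le> norm (of_real q * of_real q * of_real q :: complex)"
    unfolding norm_mult power3_eq_cube using assms by (intro mult_mono) auto
qed

text \<open>One formula for each of the four perturbations, in the order in which they occur. The
  zeros are kept so that the value at 0 is visible as a factor.\<close>

lemma factor_derivatives:
  fixes p q :: complex
  assumes "p \<noteq> 0" "q \<noteq> 0"
  shows "((\<lambda>w. p * p * (p + w) / (q * q * (q - w))) has_field_derivative
           p * p * (p + 0) / (q * q * (q - 0)) * (1 / p + 1 / q)) (at 0)"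
    "((\<lambda>w. p * p * (p + w) / (q * (q + w) * (q + w))) has_field_derivative
           p * p * (p + 0) / (q * (q + 0) * (q + 0)) * (1 / p - 2 / q)) (at 0)"
    "((\<lambda>w. p * (p\<^sup>2 - w) / (q * (q\<^sup>2 - w))) has_field_derivative
           p * (p\<^sup>2 - 0) / (q * (q\<^sup>2 - 0)) * (1 / q\<^sup>2 - 1 / p\<^sup>2)) (at 0)"
    "((\<lambda>w. p * (p\<^sup>2 - w) / (q * q * q)) has_field_derivative
           p * (p\<^sup>2 - 0) / (q * q * q) * (- 1 / p\<^sup>2)) (at 0)"
  using assms by (auto intro!: derivative_eq_intros simp: divide_simps power2_eq_square) (simp_all add: algebra_simps)

text \<open>Dixon's theorem with b = 1/2 + x raises one upper parameter and lowers the lower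
  parameter 1 + a - b. On the Gamma side the derivative is psi(3/4) - psi(1/4) + psi(1/2) - psi(1),
  that is, pi - 2 ln 2.\<close>

lemma sums_odd_harm_plus_harm:
  "(\<lambda>k. real ((2 * k) choose k) ^ 3 / 64 ^ k * (\<Sum>j<k. 1 / (real j + 1 / 2) + 1 / (real j + 1)))
     sums (pi / Gamma (3 / 4) ^ 4 * (pi - 2 * ln 2))"
proof -
  define P Q where "P = (\<lambda>j. real j + 1 / 2)" and "Q = (\<lambda>j. real j + 1)"
  have pos: "P j \<ge> 1 / 2" "Q j \<ge> 1" "P j \<noteq> 0" "Q j \<noteq> 0" for j
    by (auto simp: P_def Q_def)
  \<comment> \<open>All arguments are written as c + s * x, even for s = 0, so that
    \<open>log_derivative_Gamma\<close> matches each factor.\<close>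
  define F where "F = (\<lambda>x. Gamma (5 / 4 + 0 * x) * Gamma (1 / 4 + - 1 * x) * Gamma (1 + - 1 * x) * Gamma (1 + 0 * x) /
      (Gamma (3 / 2 + 0 * x) * Gamma (1 / 2 + - 1 * x) * Gamma (3 / 4 + - 1 * x) * Gamma (3 / 4 + 0 * x :: real)))"
  have "(\<lambda>k. real ((2 * k) choose k) ^ 3 / 64 ^ k * (\<Sum>j<k. 1 / P j + 1 / Q j))
     sums (pi / Gamma (3 / 4) ^ 4 * (pi - 2 * ln 2))"
  proof (rule sums_weighted_log_derivative[where F = F
      and N = "\<lambda>j w. of_real (P j) * of_real (P j) * (of_real (P j) + w)"
      and M = "\<lambda>j w. of_real (Q j) * of_real (Q j) * (of_real (Q j) - w)"
      and t = "\<lambda>x. term3F2 (1 / 2) (1 / 2 + x) (1 / 2) (1 + 1 / 2 - (1 / 2 + x)) (1 + 1 / 2 - 1 / 2)"])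
    fix x :: real and k :: nat
    assume x: "0 \<le> x" "x < 1 / 24"
    have "term3F2 (1 / 2) (1 / 2 + x) (1 / 2) (1 + 1 / 2 - (1 / 2 + x)) (1 + 1 / 2 - 1 / 2) k =
        (\<Prod>j<k. P j * P j * (P j + x) / (Q j * Q j * (Q j - x)))"
      unfolding term3F2_prod
      by (intro prod.cong refl arg_cong2[where f = "(/)"]; simp add: P_def Q_def algebra_simps)
    then show "complex_of_real (term3F2 (1 / 2) (1 / 2 + x) (1 / 2) (1 + 1 / 2 - (1 / 2 + x)) (1 + 1 / 2 - 1 / 2) k) =
        (\<Prod>j<k. of_real (P j) * of_real (P j) * (of_real (P j) + of_real x) /
          (of_real (Q j) * of_real (Q j) * (of_real (Q j) - of_real x)))"
      by simp
    show "term3F2 (1 / 2) (1 / 2 + x) (1 / 2) (1 + 1 / 2 - (1 / 2 + x)) (1 + 1 / 2 - 1 / 2) sums F x"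
    proof (rule sums_eq_trans[OF dixon_3F2])
      show "Gamma (1 + 1 / 2 / 2) * Gamma (1 + 1 / 2 / 2 - (1 / 2 + x) - 1 / 2) * Gamma (1 + 1 / 2 - (1 / 2 + x)) *
          Gamma (1 + 1 / 2 - 1 / 2) / (Gamma (1 + 1 / 2) * Gamma (1 + 1 / 2 - (1 / 2 + x) - 1 / 2) *
          Gamma (1 + 1 / 2 / 2 - (1 / 2 + x)) * Gamma (1 + 1 / 2 / 2 - 1 / 2)) = F x"
        unfolding F_def
        by (intro arg_cong2[where f = "(/)"] arg_cong2[where f = "(*)"] arg_cong[where f = Gamma]) auto
    qed (use x in auto)
  next
    have "(F has_field_derivative F 0 * (0 * Digamma (5 / 4) + - 1 * Digamma (1 / 4) + - 1 * Digamma 1 + 0 * Digamma 1 -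
        (0 * Digamma (3 / 2) + - 1 * Digamma (1 / 2) + - 1 * Digamma (3 / 4) + 0 * Digamma (3 / 4)))) (at 0 within {0..})"
      unfolding F_def by (intro log_derivative_intros) (simp_all add: Gamma_real_nonzero)
    moreover have "F 0 = pi / Gamma (3 / 4) ^ 4"
      using Gamma_quotient_base_value by (simp add: F_def power2_eq_square mult.assoc)
    moreover have "0 * Digamma (5 / 4) + - 1 * Digamma (1 / 4) + - 1 * Digamma 1 + 0 * Digamma 1 -
        (0 * Digamma (3 / 2) + - 1 * Digamma (1 / 2) + - 1 * Digamma (3 / 4) + 0 * Digamma (3 / 4)) = pi - 2 * ln (2 :: real)"
      using Digamma_three_quarters_minus_one_quarter by (simp add: Digamma_one_half)
    ultimately show "(F has_field_derivative pi / Gamma (3 / 4) ^ 4 * (pi - 2 * ln 2)) (at 0 within {0..})"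
      by (simp only:)
  next
    show "((\<lambda>w. of_real (P j) * of_real (P j) * (of_real (P j) + w) / (of_real (Q j) * of_real (Q j) * (of_real (Q j) - w)))
        has_field_derivative of_real (P j) * of_real (P j) * (of_real (P j) + 0) /
          (of_real (Q j) * of_real (Q j) * (of_real (Q j) - 0)) * complex_of_real (1 / P j + 1 / Q j)) (at 0)" for j
      using factor_derivatives(1)[of "of_real (P j)" "of_real (Q j)"] pos by simp
    show "cmod (of_real (P j) * of_real (P j) * (of_real (P j) + w)) \<le> (real j + 1 / 2 + 1 / 24) ^ 3"
      "(real j + 1 - 1 / 24) ^ 3 \<le> cmod (of_real (Q j) * of_real (Q j) * (of_real (Q j) - w))" if "cmod w < 1 / 24" for j w
      using norm_numerator_bounds(1)[OF that pos(1)] norm_denominator_bounds(1)[OF that pos(2)]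
      by (simp_all only: P_def Q_def)
  qed (auto simp: P_def Q_def power3_eq_cube power2_eq_square intro!: holomorphic_intros)
  then show ?thesis
    by (simp add: P_def Q_def)
qed


text \<open>With a = 1/2 + x both lower parameters become 1 + x, whence the -2 / (j + 1). On the
  Gamma side psi(5/4) and psi(3/2) are reduced by psi(z + 1) = psi(z) + 1/z, and the rational
  contributions 2 and -2 cancel.\<close>

lemma sums_odd_harm_minus_harm:
  "(\<lambda>k. real ((2 * k) choose k) ^ 3 / 64 ^ k * (\<Sum>j<k. 1 / (real j + 1 / 2) - 2 / (real j + 1)))
     sums (pi / Gamma (3 / 4) ^ 4 * (4 * ln 2 - pi))"
proof -
  define P Q where "P = (\<lambda>j. real j + 1 / 2)" and "Q = (\<lambda>j. real j + 1)"
  have pos: "P j \<ge> 1 / 2" "Q j \<ge> 1" "P j \<noteq> 0" "Q j \<noteq> 0" for j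
    by (auto simp: P_def Q_def)
  define F where "F = (\<lambda>x. Gamma (5 / 4 + 1 / 2 * x) * Gamma (1 / 4 + 1 / 2 * x) * Gamma (1 + 1 * x) * Gamma (1 + 1 * x) /
      (Gamma (3 / 2 + 1 * x) * Gamma (1 / 2 + 1 * x) * Gamma (3 / 4 + 1 / 2 * x) * Gamma (3 / 4 + 1 / 2 * x :: real)))"
  define t where "t = (\<lambda>x. term3F2 (1 / 2 + x) (1 / 2) (1 / 2) (1 + (1 / 2 + x) - 1 / 2) (1 + (1 / 2 + x) - 1 / 2))"
  have "(\<lambda>k. real ((2 * k) choose k) ^ 3 / 64 ^ k * (\<Sum>j<k. 1 / P j - 2 / Q j))
     sums (pi / Gamma (3 / 4) ^ 4 * (4 * ln 2 - pi))"
  proof (rule sums_weighted_log_derivative[where F = F and t = t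
      and N = "\<lambda>j w. of_real (P j) * of_real (P j) * (of_real (P j) + w)"
      and M = "\<lambda>j w. of_real (Q j) * (of_real (Q j) + w) * (of_real (Q j) + w)"])
    fix x :: real and k :: nat
    assume x: "0 \<le> x" "x < 1 / 24"
    have "t x k = (\<Prod>j<k. P j * P j * (P j + x) / (Q j * (Q j + x) * (Q j + x)))"
      unfolding t_def term3F2_prod
      by (intro prod.cong refl arg_cong2[where f = "(/)"]; simp add: P_def Q_def algebra_simps)
    then show "complex_of_real (t x k) =
        (\<Prod>j<k. of_real (P j) * of_real (P j) * (of_real (P j) + of_real x) /
          (of_real (Q j) * (of_real (Q j) + of_real x) * (of_real (Q j) + of_real x)))"
      by simp
    show "t x sums F x"
      unfolding t_def
    proof (rule sums_eq_trans[OF dixon_3F2])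
      show "Gamma (1 + (1 / 2 + x) / 2) * Gamma (1 + (1 / 2 + x) / 2 - 1 / 2 - 1 / 2) * Gamma (1 + (1 / 2 + x) - 1 / 2) *
          Gamma (1 + (1 / 2 + x) - 1 / 2) / (Gamma (1 + (1 / 2 + x)) * Gamma (1 + (1 / 2 + x) - 1 / 2 - 1 / 2) *
          Gamma (1 + (1 / 2 + x) / 2 - 1 / 2) * Gamma (1 + (1 / 2 + x) / 2 - 1 / 2)) = F x"
        unfolding F_def
        by (intro arg_cong2[where f = "(/)"] arg_cong2[where f = "(*)"] arg_cong[where f = Gamma]) (auto simp: add_divide_distrib)
    qed (use x in auto)
  next
    have "(F has_field_derivative F 0 * (1 / 2 * Digamma (5 / 4) + 1 / 2 * Digamma (1 / 4) + 1 * Digamma 1 + 1 * Digamma 1 -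
        (1 * Digamma (3 / 2) + 1 * Digamma (1 / 2) + 1 / 2 * Digamma (3 / 4) + 1 / 2 * Digamma (3 / 4)))) (at 0 within {0..})"
      unfolding F_def by (intro log_derivative_intros) (simp_all add: Gamma_real_nonzero)
    moreover have "F 0 = pi / Gamma (3 / 4) ^ 4"
      using Gamma_quotient_base_value by (simp add: F_def power2_eq_square mult.assoc)
    moreover have "1 / 2 * Digamma (5 / 4) + 1 / 2 * Digamma (1 / 4) + 1 * Digamma 1 + 1 * Digamma 1 -
        (1 * Digamma (3 / 2) + 1 * Digamma (1 / 2) + 1 / 2 * Digamma (3 / 4) + 1 / 2 * Digamma (3 / 4)) = 4 * ln (2 :: real) - pi"
      using Digamma_three_quarters_minus_one_quarter Digamma_plus1[of "1 / 4 :: real"] Digamma_plus1[of "1 / 2 :: real"]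
      by (simp add: Digamma_one_half field_simps)
    ultimately show "(F has_field_derivative pi / Gamma (3 / 4) ^ 4 * (4 * ln 2 - pi)) (at 0 within {0..})"
      by (simp only:)
  next
    show "((\<lambda>w. of_real (P j) * of_real (P j) * (of_real (P j) + w) / (of_real (Q j) * (of_real (Q j) + w) * (of_real (Q j) + w)))
        has_field_derivative of_real (P j) * of_real (P j) * (of_real (P j) + 0) /
          (of_real (Q j) * (of_real (Q j) + 0) * (of_real (Q j) + 0)) * complex_of_real (1 / P j - 2 / Q j)) (at 0)" for j
      using factor_derivatives(2)[of "of_real (P j)" "of_real (Q j)"] pos by simp
    show "cmod (of_real (P j) * of_real (P j) * (of_real (P j) + w)) \<le> (real j + 1 / 2 + 1 / 24) ^ 3"
      "(real j + 1 - 1 / 24) ^ 3 \<le> cmod (of_real (Q j) * (of_real (Q j) + w) * (of_real (Q j) + w))" if "cmod w < 1 / 24" for j w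
      using norm_numerator_bounds(1)[OF that pos(1)] norm_denominator_bounds(2)[OF that pos(2)]
      by (simp_all only: P_def Q_def)
  qed (auto simp: P_def Q_def power3_eq_cube power2_eq_square intro!: holomorphic_intros)
  then show ?thesis
    by (simp add: P_def Q_def)
qed

text \<open>The sum b + c = 1 does not move, so only Gamma(1 + s) Gamma(1 - s) and Gamma(3/4 + s)
  Gamma(3/4 - s) vary, and the derivative in s^2 is psi'(1) - psi'(3/4).\<close>

lemma sums_harm2_minus_odd_harm2:
  "(\<lambda>k. real ((2 * k) choose k) ^ 3 / 64 ^ k * (\<Sum>j<k. 1 / (real j + 1)\<^sup>2 - 1 / (real j + 1 / 2)\<^sup>2))
     sums (pi / Gamma (3 / 4) ^ 4 * (8 * Catalan_const - 5 * pi\<^sup>2 / 6))"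
proof -
  define P Q where "P = (\<lambda>j. real j + 1 / 2)" and "Q = (\<lambda>j. real j + 1)"
  have pos: "P j \<ge> 1 / 2" "Q j \<ge> 1" "P j \<noteq> 0" "Q j \<noteq> 0" for j
    by (auto simp: P_def Q_def)
  define F where "F = (\<lambda>x. Gamma (5 / 4) * Gamma (1 / 4) * (Gamma (1 - 1 * sqrt x) * Gamma (1 + 1 * sqrt x)) /
      (Gamma (3 / 2) * Gamma (1 / 2) * (Gamma (3 / 4 - 1 * sqrt x) * Gamma (3 / 4 + 1 * sqrt x))))"
  define t where "t = (\<lambda>x. term3F2 (1 / 2) (1 / 2 + sqrt x) (1 / 2 - sqrt x)
      (1 + 1 / 2 - (1 / 2 + sqrt x)) (1 + 1 / 2 - (1 / 2 - sqrt x)))"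
  have "(\<lambda>k. real ((2 * k) choose k) ^ 3 / 64 ^ k * (\<Sum>j<k. 1 / (Q j)\<^sup>2 - 1 / (P j)\<^sup>2))
     sums (pi / Gamma (3 / 4) ^ 4 * (8 * Catalan_const - 5 * pi\<^sup>2 / 6))"
  proof (rule sums_weighted_log_derivative[where F = F and t = t
      and N = "\<lambda>j w. of_real (P j) * ((of_real (P j))\<^sup>2 - w)"
      and M = "\<lambda>j w. of_real (Q j) * ((of_real (Q j))\<^sup>2 - w)"])
    fix x :: real and k :: nat
    assume x: "0 \<le> x" "x < 1 / 24"
    define s where "s = sqrt x"
    have s: "x = s\<^sup>2" using x by (simp add: s_def)
    \<comment> \<open>As 1/24 < 1/16; this keeps 1/2 + s and 1/2 - s inside (0, 1], as Dixon's
      theorem is stated here.\<close>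
    have "s < 1 / 4"
      unfolding s_def using x by (intro real_less_lsqrt) (auto simp: power2_eq_square)
    then have s_bounds: "0 \<le> s" "s < 1 / 4"
      using x by (auto simp: s_def)
    have "t x k = (\<Prod>j<k. P j * ((P j)\<^sup>2 - x) / (Q j * ((Q j)\<^sup>2 - x)))"
      unfolding t_def term3F2_prod s_def[symmetric] unfolding s
      by (intro prod.cong refl arg_cong2[where f = "(/)"]; simp add: P_def Q_def algebra_simps power2_eq_square)
    then show "complex_of_real (t x k) =
        (\<Prod>j<k. of_real (P j) * ((of_real (P j))\<^sup>2 - of_real x) / (of_real (Q j) * ((of_real (Q j))\<^sup>2 - of_real x)))"
      by simp
    show "t x sums F x"
      unfolding t_def s_def[symmetric]
    proof (rule sums_eq_trans[OF dixon_3F2])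
      show "Gamma (1 + 1 / 2 / 2) * Gamma (1 + 1 / 2 / 2 - (1 / 2 + s) - (1 / 2 - s)) * Gamma (1 + 1 / 2 - (1 / 2 + s)) *
          Gamma (1 + 1 / 2 - (1 / 2 - s)) / (Gamma (1 + 1 / 2) * Gamma (1 + 1 / 2 - (1 / 2 + s) - (1 / 2 - s)) *
          Gamma (1 + 1 / 2 / 2 - (1 / 2 + s)) * Gamma (1 + 1 / 2 / 2 - (1 / 2 - s))) = F x"
        unfolding F_def mult.assoc s_def[symmetric]
        by (intro arg_cong2[where f = "(/)"] arg_cong2[where f = "(*)"] arg_cong[where f = Gamma]) auto
    qed (use s_bounds in auto)
  next
    have "(F has_field_derivative F 0 * (0 + 0 + 1\<^sup>2 * Polygamma 1 1 - (0 + 0 + 1\<^sup>2 * Polygamma 1 (3 / 4)))) (at 0 within {0..})"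
      unfolding F_def
      by (rule log_derivative_Gamma_symmetric log_derivative_intros | simp add: Gamma_real_nonzero)+
    moreover have "F 0 = pi / Gamma (3 / 4) ^ 4"
      using Gamma_quotient_base_value by (simp add: F_def power2_eq_square mult.assoc)
    ultimately show "(F has_field_derivative pi / Gamma (3 / 4) ^ 4 * (8 * Catalan_const - 5 * pi\<^sup>2 / 6)) (at 0 within {0..})"
      unfolding Polygamma_1_1 Polygamma_1_three_quarters by simp
  next
    show "((\<lambda>w. of_real (P j) * ((of_real (P j))\<^sup>2 - w) / (of_real (Q j) * ((of_real (Q j))\<^sup>2 - w)))
        has_field_derivative of_real (P j) * ((of_real (P j))\<^sup>2 - 0) /
          (of_real (Q j) * ((of_real (Q j))\<^sup>2 - 0)) * complex_of_real (1 / (Q j)\<^sup>2 - 1 / (P j)\<^sup>2)) (at 0)" for j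
      using factor_derivatives(3)[of "of_real (P j)" "of_real (Q j)"] pos by simp
    show "cmod (of_real (P j) * ((of_real (P j))\<^sup>2 - w)) \<le> (real j + 1 / 2 + 1 / 24) ^ 3"
      "(real j + 1 - 1 / 24) ^ 3 \<le> cmod (of_real (Q j) * ((of_real (Q j))\<^sup>2 - w))" if "cmod w < 1 / 24" for j w
      using norm_numerator_bounds(2)[OF that pos(1)] norm_denominator_bounds(3)[OF that pos(2)]
      by (simp_all only: P_def Q_def)
  qed (auto simp: P_def Q_def power3_eq_cube power2_eq_square intro!: holomorphic_intros)
  then show ?thesis
    by (simp add: P_def Q_def)
qed

text \<open>The lower parameters stay at e = f = 1 while only the pair a, 1 - a moves, so ordinary
  harmonic numbers do not appear. The halved arguments give r = 1/2, and the symmetric product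
  occurs twice in the denominator, which yields -psi'(3/4) / 2.\<close>

lemma sums_odd_harm2:
  "(\<lambda>k. real ((2 * k) choose k) ^ 3 / 64 ^ k * (\<Sum>j<k. - 1 / (real j + 1 / 2)\<^sup>2))
     sums (pi / Gamma (3 / 4) ^ 4 * (- (pi\<^sup>2 - 8 * Catalan_const) / 2))"
proof -
  define P Q where "P = (\<lambda>j. real j + 1 / 2)" and "Q = (\<lambda>j. real j + 1)"
  have pos: "P j \<ge> 1 / 2" "Q j \<ge> 1" "P j \<noteq> 0" "Q j \<noteq> 0" for j
    by (auto simp: P_def Q_def)
  define h where "h = (\<lambda>x. Gamma (3 / 4 - 1 / 2 * sqrt x) * Gamma (3 / 4 + 1 / 2 * sqrt x))"
  define F where "F = (\<lambda>x. pi / (h x * h x))"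
  define t where "t = (\<lambda>x. term3F2 (1 / 2 + sqrt x) (1 - (1 / 2 + sqrt x)) (1 / 2) 1 1)"
  have "(\<lambda>k. real ((2 * k) choose k) ^ 3 / 64 ^ k * (\<Sum>j<k. - 1 / (P j)\<^sup>2))
     sums (pi / Gamma (3 / 4) ^ 4 * (- (pi\<^sup>2 - 8 * Catalan_const) / 2))"
  proof (rule sums_weighted_log_derivative[where F = F and t = t
      and N = "\<lambda>j w. of_real (P j) * ((of_real (P j))\<^sup>2 - w)"
      and M = "\<lambda>j w. of_real (Q j) * of_real (Q j) * of_real (Q j)"])
    fix x :: real and k :: nat
    assume x: "0 \<le> x" "x < 1 / 24"
    define s where "s = sqrt x"
    have s: "x = s\<^sup>2" using x by (simp add: s_def)
    have "s < 1 / 4"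
      unfolding s_def using x by (intro real_less_lsqrt) (auto simp: power2_eq_square)
    then have s_bounds: "0 \<le> s" "s < 1 / 4"
      using x by (auto simp: s_def)
    have "t x k = (\<Prod>j<k. P j * ((P j)\<^sup>2 - x) / (Q j * Q j * Q j))"
      unfolding t_def term3F2_prod s_def[symmetric] unfolding s
      by (intro prod.cong refl arg_cong2[where f = "(/)"]; simp add: P_def Q_def algebra_simps power2_eq_square)
    then show "complex_of_real (t x k) =
        (\<Prod>j<k. of_real (P j) * ((of_real (P j))\<^sup>2 - of_real x) / (of_real (Q j) * of_real (Q j) * of_real (Q j)))"
      by simp
    show "t x sums F x"
      unfolding t_def s_def[symmetric]
    proof (rule sums_eq_trans[OF whipple_3F2])
      have "(1 / 2 + s + 1) / 2 = 3 / 4 + 1 / 2 * s" "(1 - (1 / 2 + s) + 1) / 2 = 3 / 4 - 1 / 2 * s"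
        by (auto simp: field_simps)
      note arg = this
      show "Gamma (1 / 2) * Gamma ((1 + 1) / 2) * Gamma (1 / 2) * Gamma ((1 + 1) / 2) /
          (Gamma ((1 / 2 + s + 1) / 2) * Gamma ((1 - (1 / 2 + s) + 1) / 2) *
           Gamma ((1 / 2 + s + 1) / 2) * Gamma ((1 - (1 / 2 + s) + 1) / 2)) = F x"
        unfolding F_def h_def s_def[symmetric] arg by (simp add: Gamma_one_half_real mult_ac)
    qed (use s_bounds in auto)
  next
    have h: "(h has_field_derivative h 0 * ((1 / 2)\<^sup>2 * Polygamma 1 (3 / 4))) (at 0 within {0..})"
      unfolding h_def by (rule log_derivative_Gamma_symmetric) auto
    have h_0: "h 0 = (Gamma (3 / 4))\<^sup>2"
      by (simp add: h_def power2_eq_square)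
    have "(F has_field_derivative F 0 * (0 - ((1 / 2)\<^sup>2 * Polygamma 1 (3 / 4) + (1 / 2)\<^sup>2 * Polygamma 1 (3 / 4))))
        (at 0 within {0..})"
      unfolding F_def by (intro log_derivative_intros h) (simp_all add: h_0 Gamma_real_nonzero)
    moreover have "F 0 = pi / Gamma (3 / 4) ^ 4"
      by (simp add: F_def h_0 flip: power_add)
    moreover have "0 - ((1 / 2)\<^sup>2 * Polygamma 1 (3 / 4) + (1 / 2)\<^sup>2 * Polygamma 1 (3 / 4)) = - (pi\<^sup>2 - 8 * Catalan_const) / 2"
      unfolding Polygamma_1_three_quarters by (simp add: power2_eq_square field_simps)
    ultimately show "(F has_field_derivative pi / Gamma (3 / 4) ^ 4 * (- (pi\<^sup>2 - 8 * Catalan_const) / 2)) (at 0 within {0..})"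
      by (simp only:)
  next
    show "((\<lambda>w. of_real (P j) * ((of_real (P j))\<^sup>2 - w) / (of_real (Q j) * of_real (Q j) * of_real (Q j)))
        has_field_derivative of_real (P j) * ((of_real (P j))\<^sup>2 - 0) /
          (of_real (Q j) * of_real (Q j) * of_real (Q j)) * complex_of_real (- 1 / (P j)\<^sup>2)) (at 0)" for j
      using factor_derivatives(4)[of "of_real (P j)" "of_real (Q j)"] pos by simp
    show "cmod (of_real (P j) * ((of_real (P j))\<^sup>2 - w)) \<le> (real j + 1 / 2 + 1 / 24) ^ 3"
      "(real j + 1 - 1 / 24) ^ 3 \<le> cmod (of_real (Q j) * of_real (Q j) * of_real (Q j) :: complex)" if "cmod w < 1 / 24" for j w
      using norm_numerator_bounds(2)[OF that pos(1)] norm_denominator_bounds(4)[OF that pos(2)]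
      by (simp_all only: P_def Q_def)
  qed (auto simp: P_def Q_def power3_eq_cube power2_eq_square intro!: holomorphic_intros)
  then show ?thesis
    by (simp add: P_def Q_def)
qed

section \<open>Solving for the four series\<close>

lemma sums_drop_first:
  fixes c :: "nat \<Rightarrow> real"
  assumes "(\<lambda>k. real ((2 * k) choose k) ^ 3 / 64 ^ k * c k) sums s" "c 0 = 0" "s = s'"
  shows "(\<lambda>n. let k = Suc n in real ((2 * k) choose k) ^ 3 * c k / 64 ^ k) sums s'"
proof -
  have "(\<lambda>n. real ((2 * Suc n) choose Suc n) ^ 3 / 64 ^ Suc n * c (Suc n)) sums s"
    using assms(1,2) by (subst sums_Suc_iff) simp
  then show ?thesis
    unfolding Let_def assms(3) by (simp only: times_divide_eq_left)
qed

theorem theorem1: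
  shows "((\<lambda>n. let k = Suc n in real ((2 * k) choose k) ^ 3 * gen_harm 1 k / 64 ^ k)
           sums (2 * pi * (pi - 3 * ln 2) / (3 * Gamma (3 / 4 :: real) ^ 4)))
       \<and> ((\<lambda>n. let k = Suc n in real ((2 * k) choose k) ^ 3 * odd_harm 1 k / 64 ^ k)
           sums (pi ^ 2 / (6 * Gamma (3 / 4 :: real) ^ 4)))
       \<and> ((\<lambda>n. let k = Suc n in real ((2 * k) choose k) ^ 3 * gen_harm 2 k / 64 ^ k)
           sums (pi * (12 * Catalan_const - pi ^ 2) / (3 * Gamma (3 / 4 :: real) ^ 4)))
       \<and> ((\<lambda>n. let k = Suc n in real ((2 * k) choose k) ^ 3 * odd_harm 2 k / 64 ^ k)
           sums (pi * (pi ^ 2 - 8 * Catalan_const) / (8 * Gamma (3 / 4 :: real) ^ 4)))"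
proof -
  define u where "u = (\<lambda>k. real ((2 * k) choose k) ^ 3 / 64 ^ k)"
  define A where "A = pi / Gamma (3 / 4 :: real) ^ 4"
  have H: "(\<Sum>j<k. 1 / (real j + 1)) = gen_harm 1 k" "(\<Sum>j<k. 2 / (real j + 1)) = 2 * gen_harm 1 k"
    "(\<Sum>j<k. 1 / (real j + 1)\<^sup>2) = gen_harm 2 k" for k
    by (simp_all add: gen_harm_altdef sum_distrib_left)
  have O: "(\<Sum>j<k. 1 / (real j + 1 / 2)) = 2 * odd_harm 1 k" "(\<Sum>j<k. 1 / (real j + 1 / 2)\<^sup>2) = 4 * odd_harm 2 k"
    "(\<Sum>j<k. - 1 / (real j + 1 / 2)\<^sup>2) = - 4 * odd_harm 2 k" for k
    using odd_harm_altdef[of 1 k] odd_harm_altdef[of 2 k] by (simp_all add: sum_negf)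
  have 1: "(\<lambda>k. u k * (2 * odd_harm 1 k + gen_harm 1 k)) sums (A * (pi - 2 * ln 2))"
    using sums_odd_harm_plus_harm unfolding u_def A_def sum.distrib H O .
  have 2: "(\<lambda>k. u k * (2 * odd_harm 1 k - 2 * gen_harm 1 k)) sums (A * (4 * ln 2 - pi))"
    using sums_odd_harm_minus_harm unfolding u_def A_def sum_subtractf H O .
  have 3: "(\<lambda>k. u k * (gen_harm 2 k - 4 * odd_harm 2 k)) sums (A * (8 * Catalan_const - 5 * pi\<^sup>2 / 6))"
    using sums_harm2_minus_odd_harm2 unfolding u_def A_def sum_subtractf H O .
  have 4: "(\<lambda>k. u k * (- 4 * odd_harm 2 k)) sums (A * (- (pi\<^sup>2 - 8 * Catalan_const) / 2))"
    using sums_odd_harm2 unfolding u_def A_def O .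
  define g where "g = Gamma (3 / 4 :: real) ^ 4"
  have g: "g \<noteq> 0" by (simp add: g_def Gamma_real_nonzero)
  \<comment> \<open>(2 O + H) - (2 O - 2 H) = 3 H.\<close>
  have "(\<lambda>k. u k * gen_harm 1 k) sums (1 / 3 * (A * (pi - 2 * ln 2) - A * (4 * ln 2 - pi)))"
    using sums_mult[OF sums_diff[OF 1 2], of "1 / 3"] by (simp add: algebra_simps)
  then have "(\<lambda>n. let k = Suc n in real ((2 * k) choose k) ^ 3 * gen_harm 1 k / 64 ^ k)
      sums (2 * pi * (pi - 3 * ln 2) / (3 * Gamma (3 / 4 :: real) ^ 4))"
    unfolding u_def by (rule sums_drop_first) (use g in \<open>simp_all add: gen_harm_def A_def field_simps flip: g_def\<close>)
  \<comment> \<open>2 (2 O + H) + (2 O - 2 H) = 6 O.\<close>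
  moreover have "(\<lambda>k. u k * odd_harm 1 k) sums (1 / 6 * (2 * (A * (pi - 2 * ln 2)) + A * (4 * ln 2 - pi)))"
    using sums_mult[OF sums_add[OF sums_mult[OF 1, of 2] 2], of "1 / 6"] by (simp add: algebra_simps)
  then have "(\<lambda>n. let k = Suc n in real ((2 * k) choose k) ^ 3 * odd_harm 1 k / 64 ^ k)
      sums (pi ^ 2 / (6 * Gamma (3 / 4 :: real) ^ 4))"
    unfolding u_def
    by (rule sums_drop_first) (use g in \<open>simp_all add: odd_harm_def A_def field_simps power2_eq_square flip: g_def\<close>)
  moreover have "(\<lambda>k. u k * gen_harm 2 k) sums (A * (8 * Catalan_const - 5 * pi\<^sup>2 / 6) - A * (- (pi\<^sup>2 - 8 * Catalan_const) / 2))"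
    using sums_diff[OF 3 4] by (simp add: algebra_simps)
  then have "(\<lambda>n. let k = Suc n in real ((2 * k) choose k) ^ 3 * gen_harm 2 k / 64 ^ k)
      sums (pi * (12 * Catalan_const - pi ^ 2) / (3 * Gamma (3 / 4 :: real) ^ 4))"
    unfolding u_def
    by (rule sums_drop_first) (use g in \<open>simp_all add: gen_harm_def A_def field_simps power2_eq_square flip: g_def\<close>)
  moreover have "(\<lambda>k. u k * odd_harm 2 k) sums (- 1 / 4 * (A * (- (pi\<^sup>2 - 8 * Catalan_const) / 2)))"
    using sums_mult[OF 4, of "- 1 / 4"] by (simp add: algebra_simps)
  then have "(\<lambda>n. let k = Suc n in real ((2 * k) choose k) ^ 3 * odd_harm 2 k / 64 ^ k)
      sums (pi * (pi ^ 2 - 8 * Catalan_const) / (8 * Gamma (3 / 4 :: real) ^ 4))"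
    unfolding u_def
    by (rule sums_drop_first) (use g in \<open>simp_all add: odd_harm_def A_def field_simps power2_eq_square flip: g_def\<close>)
  ultimately show ?thesis by blast
qed

end
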